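(* Let $\mathbb{F}$ be an algebraically closed field and let $n\ge 3$. Let $S\in M_n(\mathbb{F})$ be any matrix all of whose minors (of all sizes $1,\dots,n$) are nonzero. Then for any two minimal matrices $A=\bigoplus_{i=1}^{k} J_{n_i}(\lambda_i)\in M_n(\mathbb{F})$ and $B=\bigoplus_{i=1}^{l} J_{m_i}(\mu_i)\in M_n(\mathbb{F})$ (in Jordan form), we have $d(A,S^{-1}BS)=4$ in the commuting graph $\Gamma(M_n(\mathbb{F}))$.
   Context: $J_k(\mu)\in M_k(\mathbb{F})$ is the upper-triangular elementary Jordan cell with $\mu$ on the main diagonal and $1$ on the superdiagonal (so $J_1(\mu)=\mu$). The commuting graph $\Gamma(M_n(\mathbb{F}))$ is the simple graph whose vertices are all non-scalar matrices in $M_n(\mathbb{F})$; two vertices $X\ne Y$ are joined by an edge iff $XY=YX$. $d(X,Y)$ is the length of a shortest path between vertices $X$ and $Y$. For $A\in M_n(\mathbb{F})$, $\mathcal{C}(A)=\{X\in M_n(\mathbb{F}): AX=XA\}$. A matrix $A$ is minimal if $\mathcal{C}(X)\subseteq\mathcal{C}(A)$ implies $\mathcal{C}(X)=\mathcal{C}(A)$ for every $X\in M_n(\mathbb{F})$; equivalently, $A$ is nonderogatory (every eigenvalue has geometric multiplicity one), i.e. distinct Jordan cells of its Jordan form have distinct eigenvalues. *)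

theory Defs
  imports
    "Jordan_Normal_Form.Jordan_Normal_Form"
    "Jordan_Normal_Form.Gauss_Jordan_Elimination"
    "Jordan_Normal_Form.DL_Submatrix"
    "Graph_Theory.Shortest_Path"
begin

definition centralizer_mat :: "nat \<Rightarrow> 'a :: semiring_0 mat \<Rightarrow> 'a mat set" where
  "centralizer_mat n A = {X \<in> carrier_mat n n. A * X = X * A}"

definition minimal_mat :: "nat \<Rightarrow> 'a :: semiring_0 mat \<Rightarrow> bool" where
  "minimal_mat n A \<longleftrightarrow> A \<in> carrier_mat n n \<and>
     (\<forall>X \<in> carrier_mat n n. centralizer_mat n X \<subseteq> centralizer_mat n A \<longrightarrow>
        centralizer_mat n X = centralizer_mat n A)"

definition scalar_mats :: "nat \<Rightarrow> 'a :: semiring_1 mat set" where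
  "scalar_mats n = {c \<cdot>\<^sub>m 1\<^sub>m n | c. True}"

text \<open>An undirected edge is represented, as usual in \<^verbatim>\<open>Graph_Theory\<close>, by the two
  arcs \<^term>\<open>(X, Y)\<close> and \<^term>\<open>(Y, X)\<close>. The graph is infinite when the field is, so the
  library locale \<^verbatim>\<open>graph\<close>, which includes finiteness, does not apply; the
  lemmas below show that the remaining conditions on a simple graph hold.\<close>

definition commuting_graph :: "nat \<Rightarrow> ('a :: semiring_1 mat, 'a mat \<times> 'a mat) pre_digraph" where
  "commuting_graph n = (let V = carrier_mat n n - scalar_mats n in
     \<lparr>verts = V, arcs = {(X, Y). X \<in> V \<and> Y \<in> V \<and> X \<noteq> Y \<and> X * Y = Y * X},
      tail = fst, head = snd\<rparr>)"

lemma wf_digraph_commuting_graph: "wf_digraph (commuting_graph n)"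
  by unfold_locales (auto simp: commuting_graph_def Let_def)

lemma loopfree_commuting_graph: "loopfree_digraph (commuting_graph n)"
  by unfold_locales (auto simp: commuting_graph_def Let_def)

lemma nomulti_commuting_graph: "nomulti_digraph (commuting_graph n)"
  by unfold_locales (auto simp: commuting_graph_def Let_def arc_to_ends_def)

lemma sym_commuting_graph: "sym_digraph (commuting_graph n)"
  by unfold_locales
    (force simp: commuting_graph_def Let_def symmetric_def sym_def arcs_ends_def arc_to_ends_def
      image_iff)+

text \<open>The library's shortest path distance with unit weights: the infimum of the lengths
  of all walks, hence the length of a shortest path if there is one and \<^term>\<open>\<infinity> :: ereal\<close>
  otherwise.\<close>

definition graph_dist :: "('v, 'e) pre_digraph \<Rightarrow> 'v \<Rightarrow> 'v \<Rightarrow> ereal" where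
  "graph_dist G u v = wf_digraph.\<mu> G (\<lambda>_. 1) u v"

text \<open>Restricting to index sets within the dimensions keeps \<^const>\<open>submatrix\<close> from
  describing the same minor by several pairs of sets; the empty minor is excluded.\<close>

definition all_minors_nonzero :: "'a :: comm_ring_1 mat \<Rightarrow> bool" where
  "all_minors_nonzero S \<longleftrightarrow>
     (\<forall>I J. I \<subseteq> {..<dim_row S} \<and> J \<subseteq> {..<dim_col S} \<and> card I = card J \<and> I \<noteq> {} \<longrightarrow>
        det (submatrix S I J) \<noteq> 0)"

end

theory Submission
  imports Defs
begin

text \<open>
  A nonderogatory Jordan matrix leaves only coordinate subspaces invariant, so kernel and image of
  any matrix commuting with \<open>A\<close> are coordinate subspaces, and likewise for \<open>B\<close>. On a path
  \<open>A - X - S\<^sup>-\<^sup>1 Y S - S\<^sup>-\<^sup>1 B S\<close> we may subtract scalars so that \<open>X\<close> and \<open>Y\<close> are singular and nonzero.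
  Then \<open>X\<close> maps \<open>W = S\<^sup>-\<^sup>1 (ker Y)\<close> into itself. As all minors of \<open>S\<close> are nonzero, \<open>W\<close> meets
  every coordinate subspace in the generic dimension. With \<open>k = dim W\<close> and \<open>i = dim ker X\<close>, both
  strictly between \<open>0\<close> and \<open>n\<close>, the image \<open>X W\<close> of dimension \<open>min k (n - i)\<close> lies in
  \<open>W \<inter> im X\<close>, which has dimension \<open>max 0 (k - i)\<close>; this is impossible. Conversely, two matrices of
  rank one commuting with \<open>A\<close> and \<open>S\<^sup>-\<^sup>1 B S\<close> are both annihilated on both sides by a third
  one since \<open>n \<ge> 3\<close>.
\<close>

subsection \<open>Linear systems and generic position\<close>

text \<open>Gaussian elimination: an equation with a nonzero coefficient on \<open>U\<close>
  eliminates one unknown from all the others. The equations form a set of coefficient functions, so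
  coinciding ones collapse, which only lowers their number.\<close>

lemma homogeneous_system_nontrivial:
  fixes E :: "('u \<Rightarrow> 'a :: field) set"
  assumes "finite E" "finite U" "card E < card U"
  obtains c where "\<exists>u\<in>U. c u \<noteq> 0" "\<And>\<phi>. \<phi> \<in> E \<Longrightarrow> (\<Sum>u\<in>U. \<phi> u * c u) = 0"
proof -
  have "\<exists>c. (\<exists>u\<in>U. c u \<noteq> 0) \<and> (\<forall>\<phi>\<in>E. (\<Sum>u\<in>U. \<phi> u * c u) = 0)"
    using assms
  proof (induction "card E" arbitrary: E U rule: less_induct)
    case less
    show ?case
    proof (cases "E = {}")
      case True
      with less.prems have "U \<noteq> {}" by auto
      with True show ?thesis by (auto intro!: exI[of _ "\<lambda>_. 1"])
    next
      case False
      then obtain \<psi> where \<psi>: "\<psi> \<in> E" by auto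
      define E' where "E' = E - {\<psi>}"
      have E: "E = insert \<psi> E'" "finite E'" "card E' < card E"
        using \<psi> less.prems(1) card_Diff1_less[of E \<psi>] by (auto simp: E'_def)
      show ?thesis
      proof (cases "\<forall>u\<in>U. \<psi> u = 0")
        case True
        have "card E' < card U" using E less.prems by simp
        with less.hyps[OF E(3,2) less.prems(2)] show ?thesis using True E(1) by auto
      next
        case False
        then obtain p where p: "p \<in> U" "\<psi> p \<noteq> 0" by auto
        \<comment> \<open>The multiple of \<open>\<psi>\<close> is chosen so that the coefficient at
          the pivot \<open>p\<close> vanishes.\<close>
        define elim where "elim \<phi> u = \<phi> u - \<phi> p / \<psi> p * \<psi> u" for \<phi> :: "'u \<Rightarrow> 'a" and u
        have cE: "card (elim ` E') \<le> card E'" using E(2) by (rule card_image_le)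
        have "card (elim ` E') < card E" "card (elim ` E') < card (U - {p})"
          using cE E(3) p(1) less.prems by auto
        with less.hyps[of "elim ` E'" "U - {p}"] E(2) less.prems(2)
        obtain c where c: "\<exists>u\<in>U - {p}. c u \<noteq> 0"
          and c0: "\<And>\<phi>. \<phi> \<in> E' \<Longrightarrow> (\<Sum>u\<in>U - {p}. elim \<phi> u * c u) = 0"
          by auto
        define s where "s = (\<Sum>u\<in>U - {p}. \<psi> u * c u)"
        define c' where "c' = c(p := - s / \<psi> p)"
        have sum_c': "(\<Sum>u\<in>U. \<phi> u * c' u) = \<phi> p * (- s / \<psi> p) + (\<Sum>u\<in>U - {p}. \<phi> u * c u)"
          for \<phi> :: "'u \<Rightarrow> 'a"
          using p(1) less.prems(2) by (subst sum.remove[of U p]) (auto simp: c'_def)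
        have "(\<Sum>u\<in>U. \<phi> u * c' u) = 0" if "\<phi> \<in> E" for \<phi>
        proof (cases "\<phi> = \<psi>")
          case True
          then show ?thesis using p(2) sum_c'[of \<psi>] by (simp add: s_def)
        next
          case False
          with that E(1) have "\<phi> \<in> E'" by auto
          from c0[OF this] have "(\<Sum>u\<in>U - {p}. \<phi> u * c u) = \<phi> p / \<psi> p * s"
            by (simp add: elim_def s_def algebra_simps sum_subtractf sum_distrib_left)
          then show ?thesis using sum_c'[of \<phi>] by simp
        qed
        moreover have "\<exists>u\<in>U. c' u \<noteq> 0" using c by (auto simp: c'_def)
        ultimately show ?thesis by blast
      qed
    qed
  qed
  then show ?thesis using that by blast
qed

lemma mult_mat_vec_index:
  assumes "A \<in> carrier_mat m n" "w \<in> carrier_vec n" "i < m"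
  shows "(A *\<^sub>v w) $ i = (\<Sum>j<n. A $$ (i, j) * w $ j)"
  using assms by (auto simp: scalar_prod_def atLeast0LessThan intro!: sum.cong)

text \<open>An element of \<open>T\<close> is picked at the index counting the smaller elements of
  \<open>T\<close>, which gives surjectivity; equal cardinalities then force injectivity.\<close>

lemma bij_betw_pick:
  assumes "finite T"
  shows "bij_betw (pick T) {..<card T} T"
proof -
  have sub: "T \<subseteq> pick T ` {..<card T}"
  proof
    fix t assume t: "t \<in> T"
    then have "{a \<in> T. a < t} \<subset> T" by auto
    then have "card {a \<in> T. a < t} < card T" using assms by (rule psubset_card_mono[rotated])
    then show "t \<in> pick T ` {..<card T}" using pick_card_in_set[OF t] by force
  qed
  have "card (pick T ` {..<card T}) \<le> card T" using card_image_le[of "{..<card T}" "pick T"] by simp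
  then have "T = pick T ` {..<card T}" using sub by (intro card_seteq) auto
  then show ?thesis unfolding bij_betw_def by (metis card_lessThan eq_card_imp_inj_on finite_lessThan)
qed

text \<open>The restriction of \<open>w\<close> to \<open>T\<close> lies in the kernel of a square
  submatrix with columns \<open>T\<close> and \<open>card T\<close> rows taken from
  \<open>J\<close>, whose determinant is a nonzero minor. This is the form in which generic position
  of \<open>S\<close> is used.\<close>

lemma all_minors_nonzero_imp_zero:
  fixes S :: "'a :: field mat"
  assumes S: "S \<in> carrier_mat n n" "all_minors_nonzero S" and w: "w \<in> carrier_vec n"
    and T: "T \<subseteq> {..<n}" and J: "J \<subseteq> {..<n}" and le: "card T \<le> card J"
    and supp: "\<And>j. j < n \<Longrightarrow> j \<notin> T \<Longrightarrow> w $ j = 0"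
    and zero: "\<And>j. j \<in> J \<Longrightarrow> (S *\<^sub>v w) $ j = 0"
  shows "w = 0\<^sub>v n"
proof (cases "T = {}")
  case True
  then show ?thesis using w supp by auto
next
  case False
  obtain J' where J': "J' \<subseteq> J" "card J' = card T"
    using le obtain_subset_with_card_n by metis
  have fin: "finite T" "finite J'" using T J J'(1) by (meson finite_lessThan finite_subset)+
  define m where "m = card T"
  define M where "M = submatrix S J' T"
  define v where "v = vec m (\<lambda>b. w $ pick T b)"
  have sets: "{i. i < n \<and> i \<in> J'} = J'" "{i. i < n \<and> i \<in> T} = T" using J J'(1) T by auto
  have M: "M \<in> carrier_mat m m"
    unfolding M_def carrier_mat_def by (simp add: dim_submatrix m_def J'(2)
        S(1)[unfolded carrier_mat_def, simplified] sets)
  have Mi: "M $$ (a, b) = S $$ (pick J' a, pick T b)" if "a < m" "b < m" for a b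
    unfolding M_def using S(1) that sets by (subst submatrix_index) (auto simp: m_def J'(2))
  have bT: "bij_betw (pick T) {..<m} T" and bJ: "bij_betw (pick J') {..<m} J'"
    using bij_betw_pick[OF fin(1)] bij_betw_pick[OF fin(2)] by (auto simp: m_def J'(2))
  have "(M *\<^sub>v v) $ a = 0" if a: "a < m" for a
  proof -
    let ?r = "pick J' a"
    have r: "?r \<in> J'" "?r < n" using bJ a J J'(1) by (auto simp: bij_betw_def)
    have "(M *\<^sub>v v) $ a = (\<Sum>b<m. S $$ (?r, pick T b) * w $ pick T b)"
      using a M by (subst mult_mat_vec_index[of _ m m]) (auto simp: v_def Mi)
    also have "\<dots> = (\<Sum>t\<in>T. S $$ (?r, t) * w $ t)"
      by (rule sum.reindex_bij_betw[OF bT])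
    also have "\<dots> = (\<Sum>t<n. S $$ (?r, t) * w $ t)"
      using T supp by (intro sum.mono_neutral_left) auto
    also have "\<dots> = (S *\<^sub>v w) $ ?r" using S(1) w r(2) by (simp add: mult_mat_vec_index del: index_mult_mat_vec)
    finally show ?thesis using zero r(1) J'(1) by auto
  qed
  then have "M *\<^sub>v v = 0\<^sub>v m" using M by auto
  moreover have "det M \<noteq> 0"
  proof -
    have "J' \<subseteq> {..<dim_row S}" "T \<subseteq> {..<dim_col S}" "J' \<noteq> {}"
      using S(1) J J' T False fin by auto
    then show ?thesis using S(2) J'(2) unfolding M_def all_minors_nonzero_def by blast
  qed
  ultimately have v0: "v = 0\<^sub>v m"
    using det_0_iff_vec_prod_zero_field[OF M] by (metis v_def vec_carrier)
  have "w $ t = 0" if t: "t \<in> T" for t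
  proof -
    obtain b where "b < m" "t = pick T b" using bT t by (auto simp: bij_betw_def)
    then show ?thesis using v0 by (metis v_def index_vec index_zero_vec(1))
  qed
  then show ?thesis using w supp by (intro eq_vecI) (auto simp del: index_mult_mat_vec)
qed

subsection \<open>Nonderogatory Jordan matrices\<close>

text \<open>A Jordan matrix is recorded by its diagonal \<open>d\<close> and the set \<open>l\<close> of positions carrying
  a superdiagonal one; this avoids all bookkeeping of block boundaries.\<close>

definition bidiag_mat :: "nat \<Rightarrow> (nat \<Rightarrow> 'a) \<Rightarrow> (nat \<Rightarrow> bool) \<Rightarrow> 'a :: {zero, one} mat" where
  "bidiag_mat n d l =
     mat n n (\<lambda>(i, j). if i = j then d i else if j = Suc i \<and> l i then 1 else 0)"

lemma bidiag_mat_carrier [simp]: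
  "bidiag_mat n d l \<in> carrier_mat n n"
  and bidiag_mat_dim [simp]: "dim_row (bidiag_mat n d l) = n" "dim_col (bidiag_mat n d l) = n"
  by (simp_all add: bidiag_mat_def)

text \<open>Ties \<open>d\<close> to \<open>l\<close> so that the pair describes Jordan cells: a
  superdiagonal one joins only equal diagonal entries. The value of \<open>l\<close> at the last
  position does not show in the matrix, hence the bound.\<close>

definition linked_eq :: "nat \<Rightarrow> (nat \<Rightarrow> 'a) \<Rightarrow> (nat \<Rightarrow> bool) \<Rightarrow> bool" where
  "linked_eq n d l \<longleftrightarrow> (\<forall>i. Suc i < n \<longrightarrow> l i \<longrightarrow> d (Suc i) = d i)"

text \<open>Distinct cells have distinct eigenvalues exactly if the cells are the level sets of \<open>d\<close>.\<close>

definition nonderogatory :: "nat \<Rightarrow> (nat \<Rightarrow> 'a) \<Rightarrow> (nat \<Rightarrow> bool) \<Rightarrow> bool" where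
  "nonderogatory n d l \<longleftrightarrow>
     (\<forall>i. Suc i < n \<longrightarrow> l i = (d (Suc i) = d i)) \<and>
     (\<forall>i j k. i \<le> j \<longrightarrow> j \<le> k \<longrightarrow> k < n \<longrightarrow> d i = d k \<longrightarrow> d j = d i)"

lemma nonderogatory_link:
  "nonderogatory n d l \<Longrightarrow> Suc i < n \<Longrightarrow> l i \<longleftrightarrow> d (Suc i) = d i"
  unfolding nonderogatory_def by blast

text \<open>Induction on the list of cells: the data of the remaining cells are shifted by the size
  of the first one.\<close>

lemma jordan_matrix_eq_bidiag_mat:
  fixes n_as :: "(nat \<times> 'a :: {zero, one}) list"
  obtains d l where "jordan_matrix n_as = bidiag_mat (sum_list (map fst n_as)) d l"
    "linked_eq (sum_list (map fst n_as)) d l"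
proof -
  have "\<exists>d l. jordan_matrix n_as = bidiag_mat (sum_list (map fst n_as)) d l \<and>
    linked_eq (sum_list (map fst n_as)) d l"
  proof (induction n_as)
    case Nil
    have "jordan_matrix [] = bidiag_mat 0 d l" for d :: "nat \<Rightarrow> 'a" and l
      by (rule eq_matI) (auto simp: jordan_matrix_def bidiag_mat_def)
    then show ?case by (auto simp: linked_eq_def)
  next
    case (Cons na n_as)
    obtain m a where na: "na = (m, a)" by force
    let ?N = "sum_list (map fst n_as)"
    obtain d l where IH: "jordan_matrix n_as = bidiag_mat ?N d l" "linked_eq ?N d l"
      using Cons.IH by auto
    define d' where "d' i = (if i < m then a else d (i - m))" for i
    \<comment> \<open>The test \<open>Suc i < m\<close> leaves the last position of the first cell
      unlinked, so that this cell is not joined to the next.\<close>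
    define l' where "l' i = (if i < m then Suc i < m else l (i - m))" for i
    have "jordan_matrix (na # n_as) =
        four_block_mat (jordan_block m a) (0\<^sub>m m ?N) (0\<^sub>m ?N m) (jordan_matrix n_as)"
      unfolding na jordan_matrix_def
      by (simp add: Let_def jordan_matrix_def[symmetric])
    also have "\<dots> = bidiag_mat (m + ?N) d' l'"
    proof (rule eq_matI)
      fix i j
      assume "i < dim_row (bidiag_mat (m + ?N) d' l')" "j < dim_col (bidiag_mat (m + ?N) d' l')"
      then have ij: "i < m + ?N" "j < m + ?N" by (simp_all add: bidiag_mat_def)
      have lhs: "four_block_mat (jordan_block m a) (0\<^sub>m m ?N) (0\<^sub>m ?N m) (jordan_matrix n_as) $$ (i, j) =
        (if i < m then if j < m then jordan_block m a $$ (i, j) else 0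
         else if j < m then 0 else bidiag_mat ?N d l $$ (i - m, j - m))"
        using ij by (auto simp: IH(1))
      show "four_block_mat (jordan_block m a) (0\<^sub>m m ?N) (0\<^sub>m ?N m) (jordan_matrix n_as) $$ (i, j) =
          bidiag_mat (m + ?N) d' l' $$ (i, j)"
        unfolding lhs using ij
        by (cases "i < m"; cases "j < m")
          (auto simp: bidiag_mat_def d'_def l'_def jordan_block_def Suc_diff_le)
    qed (simp_all add: bidiag_mat_def)
    finally have "jordan_matrix (na # n_as) = bidiag_mat (m + ?N) d' l'" .
    moreover have "linked_eq (m + ?N) d' l'"
      using IH(2) by (auto simp: linked_eq_def d'_def l'_def Suc_diff_le)
    ultimately show ?case by (auto simp: na)
  qed
  then show ?thesis using that by blast
qed

section \<open>Centralizers of bidiagonal matrices\<close>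

lemma bidiag_row_sum:
  fixes f :: "nat \<Rightarrow> 'a :: semiring_1"
  assumes "i < n"
  shows "(\<Sum>k<n. bidiag_mat n d l $$ (i, k) * f k) =
    d i * f i + (if Suc i < n \<and> l i then f (Suc i) else 0)"
proof -
  have "(\<Sum>k<n. bidiag_mat n d l $$ (i, k) * f k) =
    (\<Sum>k<n. (if k = i then d k * f k else 0) + (if k = Suc i then if l i then f k else 0 else 0))"
    using assms by (intro sum.cong) (auto simp: bidiag_mat_def)
  also have "\<dots> = d i * f i + (if Suc i < n \<and> l i then f (Suc i) else 0)"
    using assms by (simp add: sum.distrib)
  finally show ?thesis .
qed

lemma bidiag_col_sum:
  fixes f :: "nat \<Rightarrow> 'a :: semiring_1"
  assumes "j < n"
  shows "(\<Sum>k<n. f k * bidiag_mat n d l $$ (k, j)) =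
    f j * d j + (if 0 < j \<and> l (j - 1) then f (j - 1) else 0)"
proof -
  \<comment> \<open>For \<open>j = 0\<close> truncated subtraction gives \<open>j - 1 = 0\<close>;
    the guard \<open>0 < j\<close> suppresses the spurious term.\<close>
  have "(\<Sum>k<n. f k * bidiag_mat n d l $$ (k, j)) =
    (\<Sum>k<n. (if k = j then f k * d k else 0) +
      (if k = j - 1 then if 0 < j \<and> l (j - 1) then f k else 0 else 0))"
    using assms by (intro sum.cong) (auto simp: bidiag_mat_def)
  also have "\<dots> = f j * d j + (if 0 < j \<and> l (j - 1) then f (j - 1) else 0)"
    using assms by (auto simp add: sum.distrib)
  finally show ?thesis .
qed

lemma mult_mat_index:
  assumes "A \<in> carrier_mat m n" "B \<in> carrier_mat n k" "i < m" "j < k"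
  shows "(A * B) $$ (i, j) = (\<Sum>t<n. A $$ (i, t) * B $$ (t, j))"
  using assms by (auto simp: scalar_prod_def atLeast0LessThan intro!: sum.cong)

lemma bidiag_mult_index:
  fixes X :: "'a :: semiring_1 mat"
  assumes "X \<in> carrier_mat n n" "i < n" "j < n"
  shows "(bidiag_mat n d l * X) $$ (i, j) =
      d i * X $$ (i, j) + (if Suc i < n \<and> l i then X $$ (Suc i, j) else 0)"
    and "(X * bidiag_mat n d l) $$ (i, j) =
      X $$ (i, j) * d j + (if 0 < j \<and> l (j - 1) then X $$ (i, j - 1) else 0)"
  using assms bidiag_row_sum[OF assms(2), of d l "\<lambda>k. X $$ (k, j)"]
    bidiag_col_sum[OF assms(3), of "\<lambda>k. X $$ (i, k)" d l]
  by (simp_all add: mult_mat_index[of _ n n _ n] del: index_mult_mat)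

text \<open>Turns commutation into a recurrence linking each entry of \<open>X\<close> with its
  lower and its left neighbour; the arguments about centralizers work with this recurrence.\<close>

lemma bidiag_commute_iff:
  fixes X :: "'a :: semiring_1 mat"
  assumes X: "X \<in> carrier_mat n n"
  shows "bidiag_mat n d l * X = X * bidiag_mat n d l \<longleftrightarrow>
    (\<forall>i<n. \<forall>j<n. d i * X $$ (i, j) + (if Suc i < n \<and> l i then X $$ (Suc i, j) else 0) =
      X $$ (i, j) * d j + (if 0 < j \<and> l (j - 1) then X $$ (i, j - 1) else 0))"
  (is "?L = ?R \<longleftrightarrow> _")
proof -
  have "?L = ?R \<longleftrightarrow> (\<forall>i<n. \<forall>j<n. ?L $$ (i, j) = ?R $$ (i, j))"
  proof
    assume "\<forall>i<n. \<forall>j<n. ?L $$ (i, j) = ?R $$ (i, j)"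
    then show "?L = ?R"
      using X by (intro eq_matI) (auto simp del: index_mult_mat(1) simp: bidiag_mat_def)
  qed auto
  then show ?thesis using X by (simp add: bidiag_mult_index del: index_mult_mat)
qed

text \<open>The recurrence expresses \<open>(d i - d j) * X $$ (i, j)\<close> by the left and lower
  neighbours inside the same pair of cells. Induction from the lower left corner, with a measure
  that drops on moving down or left, shows that these vanish.\<close>

lemma bidiag_commute_zero:
  fixes X :: "'a :: field mat"
  assumes X: "X \<in> carrier_mat n n" and comm: "bidiag_mat n d l * X = X * bidiag_mat n d l"
    and l: "linked_eq n d l" and "i < n" "j < n" "d i \<noteq> d j"
  shows "X $$ (i, j) = 0"
  using assms(4-)
proof (induction "n - i + j" arbitrary: i j rule: less_induct)
  case less
  have "X $$ (Suc i, j) = 0" if "Suc i < n" "l i"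
    using less.prems that l by (intro less.hyps) (auto simp: linked_eq_def)
  moreover have "X $$ (i, j - 1) = 0" if "0 < j" "l (j - 1)"
  proof -
    have "d j = d (j - 1)" using l that less.prems by (cases j) (auto simp: linked_eq_def)
    then show ?thesis using that less.prems by (intro less.hyps) auto
  qed
  moreover note comm[unfolded bidiag_commute_iff[OF X], rule_format, OF less.prems(1,2)]
  ultimately have "d i * X $$ (i, j) = X $$ (i, j) * d j"
    by (simp split: if_splits)
  then show ?case using less.prems(3) by (metis mult.commute mult_cancel_right)
qed

section \<open>Minimal Jordan matrices are nonderogatory\<close>

definition matrix_unit :: "nat \<Rightarrow> nat \<Rightarrow> nat \<Rightarrow> 'a :: {zero, one} mat" where
  "matrix_unit n s e = mat n n (\<lambda>(i, j). if i = s \<and> j = e then 1 else 0)"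

lemma matrix_unit_carrier [simp]: "matrix_unit n s e \<in> carrier_mat n n"
  by (simp add: matrix_unit_def)

text \<open>Replacing the eigenvalues of the cells by pairwise distinct ones can only shrink the
  centralizer, and it shrinks strictly if two cells shared an eigenvalue: then a matrix unit
  from the end of one cell to the start of another is lost.\<close>

lemma minimal_bidiag_nonderogatory:
  fixes d :: "nat \<Rightarrow> 'a :: field"
  assumes inf: "infinite (UNIV :: 'a set)" and min: "minimal_mat n (bidiag_mat n d l)"
    and l: "linked_eq n d l"
  shows "nonderogatory n d l"
proof -
  let ?A = "bidiag_mat n d l"
  \<comment> \<open>The number of breaks before position \<open>i\<close>, which numbers the cell
    containing \<open>i\<close>.\<close>
  define b where "b i = card {t. t < i \<and> \<not> l t}" for i
  have b_Suc: "b (Suc i) = (if l i then b i else Suc (b i))" for i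
  proof -
    have "{t. t < Suc i \<and> \<not> l t} = (if l i then {} else {i}) \<union> {t. t < i \<and> \<not> l t}"
      by (auto simp: less_Suc_eq)
    then show ?thesis by (simp add: b_def)
  qed
  have mono: "b i \<le> b j" if "i \<le> j" for i j
    using that by (induction rule: dec_induct) (auto simp: b_Suc)
  have const: "d k = d i" if "i \<le> k" "k < n" "b k = b i" for i k
    using that
  proof (induction k rule: dec_induct)
    case (step k)
    have "b i \<le> b k" "b k \<le> b (Suc k)" using step.hyps mono by simp_all
    with step.prems have "b k = b i" "b (Suc k) = b k" by simp_all
    with step l show ?case by (auto simp: b_Suc linked_eq_def split: if_splits)
  qed simp
  have const': "d k = d i" if "i < n" "k < n" "b k = b i" for i k
    using that const[of i k] const[of k i] by (cases "i \<le> k") auto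
  \<comment> \<open>The field is infinite, so every cell number can receive an eigenvalue of its
    own.\<close>
  obtain c :: "nat \<Rightarrow> 'a" where c: "inj c"
    using inf infinite_countable_subset by blast
  define d' where "d' i = c (b i)" for i
  let ?A' = "bidiag_mat n d' l"
  have d'_eq: "d' i = d' j \<longleftrightarrow> b i = b j" for i j
    using c by (auto simp: d'_def inj_def)
  have l': "linked_eq n d' l" by (auto simp: linked_eq_def d'_eq b_Suc)
  have "centralizer_mat n ?A' \<subseteq> centralizer_mat n ?A"
  proof
    fix X assume "X \<in> centralizer_mat n ?A'"
    then have X: "X \<in> carrier_mat n n" and comm: "?A' * X = X * ?A'"
      by (auto simp: centralizer_mat_def)
    have "d i * X $$ (i, j) + (if Suc i < n \<and> l i then X $$ (Suc i, j) else 0) =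
      X $$ (i, j) * d j + (if 0 < j \<and> l (j - 1) then X $$ (i, j - 1) else 0)"
      if ij: "i < n" "j < n" for i j
    proof -
      note eq = comm[unfolded bidiag_commute_iff[OF X], rule_format, OF ij]
      \<comment> \<open>For positions in the same cell the diagonal terms agree on both sides of
        either recurrence. For positions in different cells the entry itself vanishes, and the
        diagonal terms with it.\<close>
      show ?thesis
      proof (cases "b i = b j")
        case True
        have transfer: "p * x + u = x * q + v" if "p' * x + u = x * q' + v" "p' = q'" "p = q"
          for p q p' q' x u v :: 'a
          using that by (simp add: mult.commute)
        have "d i = d j" using const'[OF ij(2,1)] True by blast
        moreover have "d' i = d' j" using True by (simp add: d'_eq)
        ultimately show ?thesis using transfer[OF eq] by blast
      next
        case False
        then have "X $$ (i, j) = 0"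
          using bidiag_commute_zero[OF X comm l' ij] by (simp add: d'_eq)
        with eq show ?thesis by (simp only: mult_zero_left mult_zero_right)
      qed
    qed
    then have "?A * X = X * ?A" unfolding bidiag_commute_iff[OF X] by blast
    then show "X \<in> centralizer_mat n ?A" using X by (simp add: centralizer_mat_def)
  qed
  then have ceq: "centralizer_mat n ?A' = centralizer_mat n ?A"
    using min unfolding minimal_mat_def by simp
  have sep: "b i = b k" if ik: "i < n" "k < n" "d i = d k" for i k
  proof (rule ccontr)
    assume ne: "b i \<noteq> b k"
    \<comment> \<open>\<open>s\<close> starts the cell of \<open>i\<close> and \<open>e\<close> ends
      the cell of \<open>k\<close>, so column \<open>s\<close> and row \<open>e\<close> of both
      bidiagonal matrices contain only the diagonal entry. Hence the matrix unit at
      \<open>(s, e)\<close> commutes with such a matrix exactly if its two diagonal entries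
      agree.\<close>
    define s where "s = (LEAST s. b s = b i)"
    define e where "e = Max {e. e < n \<and> b e = b k}"
    have s: "b s = b i" unfolding s_def by (rule LeastI[of _ i]) simp
    have "s \<le> i" unfolding s_def by (rule Least_le) simp
    with ik have sn: "s < n" by simp
    have "e \<in> {e. e < n \<and> b e = b k}" unfolding e_def using ik by (intro Max_in) auto
    then have e: "e < n" "b e = b k" by auto
    have s_start: "\<not> l x" if "Suc x = s" for x
    proof
      assume "l x"
      then have "b x = b i" using s that b_Suc[of x] by simp
      then have "s \<le> x" unfolding s_def by (rule Least_le)
      then show False using that by simp
    qed
    have e_end: "\<not> l e" if "Suc e < n"
    proof
      assume "l e"
      then have "Suc e \<in> {e. e < n \<and> b e = b k}" using that e b_Suc[of e] by simp
      then have "Suc e \<le> e" unfolding e_def by (intro Max_ge) auto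
      then show False by simp
    qed
    define E :: "'a mat" where "E = matrix_unit n s e"
    have E: "E \<in> carrier_mat n n" by (simp add: E_def)
    have "d s = d i" "d e = d k" using const'[OF ik(1) sn s] const'[OF ik(2) e] by simp_all
    then have "d s = d e" using ik(3) by simp
    then have "?A * E = E * ?A"
      unfolding bidiag_commute_iff[OF E] using s_start e_end by (auto simp: E_def matrix_unit_def)
    then have "E \<in> centralizer_mat n ?A'" using E ceq by (simp add: centralizer_mat_def)
    then have "?A' * E = E * ?A'" by (simp add: centralizer_mat_def)
    from this[unfolded bidiag_commute_iff[OF E], rule_format, OF sn e(1)]
    have "d' s = d' e" using sn e(1) by (auto simp: E_def matrix_unit_def split: if_splits)
    then show False using s e ne by (simp add: d'_eq)
  qed
  show ?thesis unfolding nonderogatory_def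
  proof (intro conjI allI impI)
    fix i assume i: "Suc i < n"
    show "l i = (d (Suc i) = d i)"
      using sep[of i "Suc i"] i l b_Suc[of i] by (auto simp: linked_eq_def split: if_splits)
  next
    fix i j k assume ijk: "i \<le> j" "j \<le> k" "k < n" "d i = d k"
    then have "b i = b k" by (intro sep) auto
    moreover have "b i \<le> b j" "b j \<le> b k" using ijk mono by auto
    ultimately show "d j = d i" using ijk by (intro const) auto
  qed
qed

lemma nonderogatory_linked_eq: "nonderogatory n d l \<Longrightarrow> linked_eq n d l"
  by (auto simp: nonderogatory_def linked_eq_def)

text \<open>Eigenvalue \<open>d 0\<close> occurs only in the first cell. Inside that cell the
  recurrence at row \<open>i - 1\<close> and column 0 has equal diagonal terms on both sides, so the
  entry below must vanish. Thus the first unit vector is an eigenvector of \<open>X\<close>.\<close>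

lemma nonderogatory_commute_col0:
  fixes X :: "'a :: field mat"
  assumes X: "X \<in> carrier_mat n n" and comm: "bidiag_mat n d l * X = X * bidiag_mat n d l"
    and nd: "nonderogatory n d l" and i: "0 < i" "i < n"
  shows "X $$ (i, 0) = 0"
proof (cases "d i = d 0")
  case False
  then show ?thesis
    using bidiag_commute_zero[OF X comm nonderogatory_linked_eq[OF nd]] i by simp
next
  case True
  obtain k where k: "i = Suc k" using i(1) by (cases i) auto
  have dk: "d k = d 0"
    using nd[unfolded nonderogatory_def, THEN conjunct2, rule_format, of 0 k i] True i k by simp
  moreover have "l k"
    using nonderogatory_link[OF nd, of k] True dk i k by simp
  moreover have "d k * X $$ (k, 0) + (if Suc k < n \<and> l k then X $$ (Suc k, 0) else 0) = X $$ (k, 0) * d 0"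
    using comm[unfolded bidiag_commute_iff[OF X], rule_format, of k 0] i k by simp
  ultimately show ?thesis using i k by simp
qed

text \<open>Over a finite field the product of all linear factors vanishes everywhere, so adding 1
  gives a nonconstant polynomial without roots.\<close>

lemma infinite_UNIV_alg_closed_field: "infinite (UNIV :: 'a :: alg_closed_field set)"
proof
  assume fin: "finite (UNIV :: 'a set)"
  define p :: "'a poly" where "p = (\<Prod>a\<in>UNIV. [:- a, 1:])"
  have deg: "degree p = card (UNIV :: 'a set)"
    unfolding p_def by (subst degree_prod_eq_sum_degree) auto
  have "degree (p + 1) = degree p"
    by (rule degree_add_eq_left) (use deg fin in \<open>auto simp: card_gt_0_iff\<close>)
  then have "degree (p + 1) > 0" using deg fin by (simp add: card_gt_0_iff)
  then obtain x where "poly (p + 1) x = 0" using alg_closed_imp_poly_has_root by blast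
  moreover have "poly p x = 0" using fin by (auto simp: p_def poly_prod prod_zero_iff)
  ultimately show False by simp
qed

section \<open>Invariant subspaces of nonderogatory Jordan matrices\<close>

lemma bidiag_mult_vec_index:
  fixes w :: "'a :: semiring_1 vec"
  assumes "w \<in> carrier_vec n" "i < n"
  shows "(bidiag_mat n d l *\<^sub>v w) $ i = d i * w $ i + (if Suc i < n \<and> l i then w $ Suc i else 0)"
  using mult_mat_vec_index[OF bidiag_mat_carrier assms] bidiag_row_sum[OF assms(2)] by metis

text \<open>Subtracts \<open>w $ t\<close> times the unit vector for each \<open>t\<close> in turn;
  this serves to isolate a single coordinate of a vector in \<open>W\<close>.\<close>

lemma subspace_clear_entries:
  fixes W :: "'a :: field vec set"
  assumes W: "W \<subseteq> carrier_vec n"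
    and add: "\<And>u v. u \<in> W \<Longrightarrow> v \<in> W \<Longrightarrow> u + v \<in> W"
    and smult: "\<And>c u. u \<in> W \<Longrightarrow> c \<cdot>\<^sub>v u \<in> W"
    and "w \<in> W" "finite T" "\<And>t. t \<in> T \<Longrightarrow> t < n \<and> unit_vec n t \<in> W"
  shows "vec n (\<lambda>i. if i \<in> T then 0 else w $ i) \<in> W"
  using assms(5,6)
proof (induction T)
  case empty
  have "vec n (\<lambda>i. if i \<in> {} then 0 else w $ i) = w"
    using assms(4) W by (intro eq_vecI) auto
  then show ?case using assms(4) by simp
next
  case (insert t T)
  let ?u = "vec n (\<lambda>i. if i \<in> T then 0 else w $ i)"
  have "?u + (- w $ t) \<cdot>\<^sub>v unit_vec n t \<in> W"
    using insert by (intro add smult) auto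
  also have "?u + (- w $ t) \<cdot>\<^sub>v unit_vec n t = vec n (\<lambda>i. if i \<in> insert t T then 0 else w $ i)"
    using insert by (intro eq_vecI) (auto simp: unit_vec_def)
  finally show ?case .
qed

text \<open>An induction on the union of the initial segments of the cells met by \<open>w\<close>: applying
  \<open>A - d t\<close> shortens the segment of \<open>t\<close> and keeps those of the other eigenvalues.\<close>

lemma nonderogatory_invariant_subspace:
  fixes W :: "'a :: field vec set"
  assumes nd: "nonderogatory n d l"
    and W: "W \<subseteq> carrier_vec n"
    and add: "\<And>u v. u \<in> W \<Longrightarrow> v \<in> W \<Longrightarrow> u + v \<in> W"
    and smult: "\<And>c u. u \<in> W \<Longrightarrow> c \<cdot>\<^sub>v u \<in> W"
    and inv: "\<And>u. u \<in> W \<Longrightarrow> bidiag_mat n d l *\<^sub>v u \<in> W"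
    and "w \<in> W" "i < n" "w $ i \<noteq> 0"
  shows "unit_vec n i \<in> W"
proof -
  have link: "l i \<longleftrightarrow> d (Suc i) = d i" if "Suc i < n" for i
    using nd that by (rule nonderogatory_link)
  have contig: "d j = d i" if "i \<le> j" "j \<le> k" "k < n" "d i = d k" for i j k
    using nd that unfolding nonderogatory_def by blast
  define seg where "seg w = {i. i < n \<and> (\<exists>p. i \<le> p \<and> p < n \<and> d p = d i \<and> w $ p \<noteq> 0)}"
    for w :: "'a vec"
  define shift where "shift c w = bidiag_mat n d l *\<^sub>v w + (- c) \<cdot>\<^sub>v w" for c and w :: "'a vec"
  have shift_index: "shift c w $ i = (d i - c) * w $ i + (if Suc i < n \<and> l i then w $ Suc i else 0)"
    if "w \<in> W" "i < n" for c w i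
  proof -
    have w: "w \<in> carrier_vec n" using that W by auto
    have "shift c w $ i = (bidiag_mat n d l *\<^sub>v w) $ i + (- c) * w $ i"
      unfolding shift_def using w that(2) by (subst index_add_vec) auto
    then show ?thesis
      unfolding bidiag_mult_vec_index[OF w that(2)] by (simp add: algebra_simps)
  qed
  have shift_W: "shift c w \<in> W" if "w \<in> W" for c w
    unfolding shift_def using that add smult inv by blast
  have "\<forall>i\<in>seg w. unit_vec n i \<in> W" if "w \<in> W" for w
    using that
  proof (induction "card (seg w)" arbitrary: w rule: less_induct)
    case less
    note w = \<open>w \<in> W\<close>
    \<comment> \<open>The last position in the cell of \<open>t\<close> at which \<open>w\<close> is
      nonzero, that is, the end of the segment of \<open>t\<close>.\<close>
    define top where "top t = Max {p. p < n \<and> d p = d t \<and> w $ p \<noteq> 0}" for t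
    have top: "top t < n" "d (top t) = d t" "w $ top t \<noteq> 0" "t \<le> top t"
      and top_max: "\<And>q. q < n \<Longrightarrow> d q = d t \<Longrightarrow> w $ q \<noteq> 0 \<Longrightarrow> q \<le> top t"
      if t: "t \<in> seg w" for t
    proof -
      let ?P = "{p. p < n \<and> d p = d t \<and> w $ p \<noteq> 0}"
      obtain p where p: "p \<in> ?P" "t \<le> p" using t by (auto simp: seg_def)
      have fin: "finite ?P" by simp
      have "top t \<in> ?P" unfolding top_def using fin p(1) by (intro Max_in) auto
      then show "top t < n" "d (top t) = d t" "w $ top t \<noteq> 0" by auto
      show max: "q \<le> top t" if "q < n" "d q = d t" "w $ q \<noteq> 0" for q
        unfolding top_def using fin that by (intro Max_ge) auto
      show "t \<le> top t" using max[of p] p by auto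
    qed
    have seg_shift: "seg (shift c w) \<subseteq> seg w" for c
    proof
      fix i assume "i \<in> seg (shift c w)"
      then obtain q where q: "i < n" "i \<le> q" "q < n" "d q = d i" "shift c w $ q \<noteq> 0"
        by (auto simp: seg_def)
      then have "w $ q \<noteq> 0 \<or> (Suc q < n \<and> l q \<and> w $ Suc q \<noteq> 0)"
        using shift_index[OF w q(3)] by (auto split: if_splits)
      then show "i \<in> seg w"
      proof
        assume "w $ q \<noteq> 0"
        then show ?thesis using q by (auto simp: seg_def)
      next
        assume "Suc q < n \<and> l q \<and> w $ Suc q \<noteq> 0"
        moreover from this have "d (Suc q) = d i" using link q by auto
        ultimately show ?thesis using q by (auto simp: seg_def intro!: exI[of _ "Suc q"])
      qed
    qed
    \<comment> \<open>Passing to \<open>shift (d t) w\<close> drops \<open>top t\<close> from the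
      segments, so the induction hypothesis covers every position that survives.\<close>
    have IH: "unit_vec n i \<in> W" if t: "t \<in> seg w" and i: "i \<in> seg (shift (d t) w)" for t i
    proof -
      have "top t \<notin> seg (shift (d t) w)"
      proof
        assume "top t \<in> seg (shift (d t) w)"
        then obtain q where q: "top t \<le> q" "q < n" "d q = d (top t)" "shift (d t) w $ q \<noteq> 0"
          by (auto simp: seg_def)
        have dq: "d q = d t" using q(3) top(2)[OF t] by simp
        then have "Suc q < n \<and> l q \<and> w $ Suc q \<noteq> 0"
          using q(4) shift_index[OF w q(2)] by (auto split: if_splits)
        moreover from this have "d (Suc q) = d t" using link dq by auto
        ultimately have "Suc q \<le> top t" using top_max[OF t] by blast
        then show False using q(1) by simp
      qed
      moreover have "top t \<in> seg w" using top[OF t] by (auto simp: seg_def)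
      ultimately have "seg (shift (d t) w) \<subset> seg w" using seg_shift by blast
      moreover have "finite (seg w)" by (simp add: seg_def)
      ultimately have "card (seg (shift (d t) w)) < card (seg w)" by (rule psubset_card_mono[rotated])
      from less.hyps[OF this shift_W[OF w]] i show ?thesis by blast
    qed
    show ?case
    proof
      fix h assume h: "h \<in> seg w"
      let ?p = "top h"
      note p = top[OF h]
      show "unit_vec n h \<in> W"
      proof (cases "\<exists>t\<in>seg w. d t \<noteq> d h")
        \<comment> \<open>Another eigenvalue is present: subtracting it multiplies the entry at
          \<open>?p\<close> by a nonzero factor, so \<open>h\<close> survives the shift.\<close>
        case True
        then obtain t where t: "t \<in> seg w" "d t \<noteq> d h" by blast
        have "\<not> (Suc ?p < n \<and> l ?p \<and> w $ Suc ?p \<noteq> 0)"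
          using top_max[OF h, of "Suc ?p"] link[of ?p] p(2) by auto
        then have "shift (d t) w $ ?p = (d ?p - d t) * w $ ?p"
          using shift_index[OF w p(1), of "d t"] by auto
        then have "shift (d t) w $ ?p \<noteq> 0" using t(2) p(2,3) by auto
        then have "h \<in> seg (shift (d t) w)" using p h unfolding seg_def by auto
        then show ?thesis using IH t(1) by blast
      next
        case False
        \<comment> \<open>Only one eigenvalue is left: \<open>shift (d h)\<close> moves the entry at
          \<open>?p\<close> to the position before it, which yields the unit vectors of all earlier
          positions. The one at \<open>?p\<close> then comes from \<open>w\<close> by clearing the
          other entries.\<close>
        have below: "unit_vec n i \<in> W" if i: "i \<in> seg w" "i \<noteq> ?p" for i
        proof -
          have di: "d i = d h" using False i by blast
          then have "i < ?p" using top(4)[OF i(1)] i(2) by (simp add: top_def)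
          then obtain q where q: "?p = Suc q" "i \<le> q" by (cases ?p) auto
          have dq: "d q = d i" using contig[of i q ?p] q p di by simp
          then have "l q" using link[of q] q p di by simp
          then have "shift (d h) w $ q = w $ ?p"
            using shift_index[OF w, of q "d h"] q p dq di by simp
          then have "i \<in> seg (shift (d h) w)"
            unfolding seg_def using q p di dq by (auto intro!: exI[of _ q])
          then show ?thesis using IH[OF h] by blast
        qed
        show ?thesis
        proof (cases "h = ?p")
          case True
          let ?T = "seg w - {?p}"
          have "vec n (\<lambda>i. if i \<in> ?T then 0 else w $ i) \<in> W"
            using below by (intro subspace_clear_entries[OF W add smult w]) (auto simp: seg_def)
          also have "vec n (\<lambda>i. if i \<in> ?T then 0 else w $ i) = w $ ?p \<cdot>\<^sub>v unit_vec n ?p"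
          proof (intro eq_vecI)
            fix i assume "i < dim_vec (w $ ?p \<cdot>\<^sub>v unit_vec n ?p)"
            then have i: "i < n" by simp
            then have "i \<in> seg w" if "w $ i \<noteq> 0" using that by (auto simp: seg_def)
            then show "vec n (\<lambda>i. if i \<in> ?T then 0 else w $ i) $ i = (w $ ?p \<cdot>\<^sub>v unit_vec n ?p) $ i"
              using i p(1) by (auto simp: unit_vec_def)
          qed simp
          finally have "inverse (w $ ?p) \<cdot>\<^sub>v (w $ ?p \<cdot>\<^sub>v unit_vec n ?p) \<in> W" by (rule smult)
          then show ?thesis using p(3) True by (simp add: smult_smult_assoc)
        next
          case False
          then show ?thesis using below h by blast
        qed
      qed
    qed
  qed
  moreover have "i \<in> seg w" using assms(7,8) by (auto simp: seg_def)
  ultimately show ?thesis using assms(6) by blast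
qed

subsection \<open>No path of length three\<close>

lemma mult_mat_vec_cong_off_zero_cols:
  fixes X :: "'a :: field mat"
  assumes X: "X \<in> carrier_mat n n" and w: "w \<in> carrier_vec n" and v: "v \<in> carrier_vec n"
    and I: "\<And>i j. i \<in> I \<Longrightarrow> j < n \<Longrightarrow> X $$ (j, i) = 0"
    and eq: "\<And>j. j < n \<Longrightarrow> j \<notin> I \<Longrightarrow> w $ j = v $ j"
  shows "X *\<^sub>v w = X *\<^sub>v v"
proof (rule eq_vecI)
  fix i assume "i < dim_vec (X *\<^sub>v v)"
  then have i: "i < n" using X by simp
  have "X $$ (i, j) * w $ j = X $$ (i, j) * v $ j" if "j < n" for j
    using I[of j i] eq[of j] i that by (cases "j \<in> I") auto
  then show "(X *\<^sub>v w) $ i = (X *\<^sub>v v) $ i"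
    unfolding mult_mat_vec_index[OF X w i] mult_mat_vec_index[OF X v i] by (intro sum.cong) auto
qed (use X in simp)

text \<open>The hypotheses say that kernel and image of \<open>X\<close> are spanned by the unit
  vectors indexed by \<open>I\<close> and \<open>R\<close>; \<open>W\<close> is the preimage under
  \<open>S\<close> of the span indexed by \<open>K\<close>. Dimensions are replaced by
  cardinalities: nonzero vectors come from underdetermined systems, and the minors of
  \<open>S\<close> force vectors of small support to vanish.\<close>

lemma generic_no_invariant_preimage:
  fixes S X :: "'a :: field mat"
  assumes S: "S \<in> carrier_mat n n" "all_minors_nonzero S" and X: "X \<in> carrier_mat n n"
    and sub: "I \<subseteq> {..<n}" "R \<subseteq> {..<n}" "K \<subseteq> {..<n}"
    and ne: "I \<noteq> {}" "R \<noteq> {}" "K \<noteq> {}" "K \<noteq> {..<n}"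
    and I_col: "\<And>i j. i \<in> I \<Longrightarrow> j < n \<Longrightarrow> X $$ (j, i) = 0"
    and ker: "\<And>w j. w \<in> carrier_vec n \<Longrightarrow> X *\<^sub>v w = 0\<^sub>v n \<Longrightarrow> j < n \<Longrightarrow> j \<notin> I \<Longrightarrow> w $ j = 0"
    and im: "\<And>r. r \<in> R \<Longrightarrow> \<exists>v\<in>carrier_vec n. X *\<^sub>v v = unit_vec n r"
    and im': "\<And>v j. v \<in> carrier_vec n \<Longrightarrow> j < n \<Longrightarrow> j \<notin> R \<Longrightarrow> (X *\<^sub>v v) $ j = 0"
  defines "W \<equiv> {w \<in> carrier_vec n. \<forall>j\<in>{..<n} - K. (S *\<^sub>v w) $ j = 0}"
  assumes inv: "\<And>w. w \<in> W \<Longrightarrow> X *\<^sub>v w \<in> W"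
  shows False
proof -
  have fin: "finite I" "finite R" "finite K" using sub finite_subset[OF _ finite_lessThan] by blast+
  have card_pos: "card I > 0" "card K > 0" using ne fin by (auto simp: card_gt_0_iff)
  have card_lt: "card K < n" using sub(3) ne(4) psubset_card_mono[OF finite_lessThan, of K n] by auto
  have card_compl: "card ({..<n} - K) = n - card K" using sub(3) fin(3) by (simp add: card_Diff_subset)
  \<comment> \<open>\<open>W\<close> is cut out by \<open>n - card K\<close> equations, so it meets
    a coordinate subspace of at most that dimension only in zero.\<close>
  have generic: "w = 0\<^sub>v n"
    if "w \<in> W" "T \<subseteq> {..<n}" "card T \<le> n - card K" "\<And>j. j < n \<Longrightarrow> j \<notin> T \<Longrightarrow> w $ j = 0" for w T
    using that by (intro all_minors_nonzero_imp_zero[OF S, of w T "{..<n} - K"])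
      (auto simp: W_def card_compl simp del: index_mult_mat_vec)
  have S_sum: "(S *\<^sub>v w) $ j = (\<Sum>u<n. S $$ (j, u) * w $ u)" if "w \<in> carrier_vec n" "j < n" for w j
    using mult_mat_vec_index[OF S(1)] that by blast
  \<comment> \<open>One half of rank-nullity: if \<open>R\<close> were larger, the preimages of its
    unit vectors would be dependent modulo the kernel, and applying \<open>X\<close> would make
    these unit vectors dependent.\<close>
  have rank: "card R \<le> n - card I"
  proof (rule ccontr)
    assume gt: "\<not> card R \<le> n - card I"
    from im obtain v where v: "\<And>r. r \<in> R \<Longrightarrow> v r \<in> carrier_vec n"
      and Xv: "\<And>r. r \<in> R \<Longrightarrow> X *\<^sub>v v r = unit_vec n r" by metis
    let ?E = "(\<lambda>j r. v r $ j) ` ({..<n} - I)"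
    have "card ?E \<le> card ({..<n} - I)" by (rule card_image_le) simp
    also have "\<dots> = n - card I" using sub(1) fin(1) by (simp add: card_Diff_subset)
    finally have "card ?E < card R" using gt by simp
    then obtain c where c: "\<exists>r\<in>R. c r \<noteq> 0"
      and c0: "\<And>\<phi>. \<phi> \<in> ?E \<Longrightarrow> (\<Sum>r\<in>R. \<phi> r * c r) = 0"
      using homogeneous_system_nontrivial[of ?E R] fin(2) by blast
    define z where "z = vec n (\<lambda>j. \<Sum>r\<in>R. v r $ j * c r)"
    have z: "z \<in> carrier_vec n" by (simp add: z_def)
    have "X *\<^sub>v z = X *\<^sub>v 0\<^sub>v n"
      using c0 by (intro mult_mat_vec_cong_off_zero_cols[OF X z _ I_col]) (auto simp: z_def)
    then have Xz: "X *\<^sub>v z = 0\<^sub>v n" using X by (intro eq_vecI) auto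
    have "c r = 0" if r: "r \<in> R" for r
    proof -
      have rn: "r < n" using r sub(2) by auto
      have "0 = (X *\<^sub>v z) $ r" unfolding Xz using rn by simp
      also have "\<dots> = (\<Sum>j<n. X $$ (r, j) * (\<Sum>s\<in>R. v s $ j * c s))"
        unfolding mult_mat_vec_index[OF X z rn] by (simp add: z_def)
      also have "\<dots> = (\<Sum>s\<in>R. c s * (\<Sum>j<n. X $$ (r, j) * v s $ j))"
        by (simp add: sum_distrib_left mult.assoc mult.commute mult.left_commute)
          (rule sum.swap)
      also have "\<dots> = (\<Sum>s\<in>R. c s * unit_vec n s $ r)"
        using Xv mult_mat_vec_index[OF X v rn] by (intro sum.cong) auto
      also have "\<dots> = (\<Sum>s\<in>R. if s = r then c s else 0)"
        using rn sub(2) by (intro sum.cong) (auto simp: unit_vec_def)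
      also have "\<dots> = c r" using r fin(2) by simp
      finally show ?thesis by simp
    qed
    with c show False by blast
  qed
  show False
  proof (cases "n \<le> card K + card I")
    \<comment> \<open>Here \<open>W\<close> is complementary to the span indexed by a suitable
      \<open>I0\<close> inside \<open>I\<close>, so \<open>X\<close> maps \<open>W\<close> onto its
      whole image. Then \<open>W\<close> would contain a unit vector.\<close>
    case True
    then have "n - card K \<le> card I" by simp
    then obtain I0 where I0: "I0 \<subseteq> I" "card I0 = n - card K"
      using obtain_subset_with_card_n by metis
    have fin0: "finite I0" "I0 \<subseteq> {..<n}" using I0 fin(1) sub(1) finite_subset by auto
    obtain r where r: "r \<in> R" using ne(2) by blast
    then have rn: "r < n" using sub(2) by auto
    obtain v where v: "v \<in> carrier_vec n" "X *\<^sub>v v = unit_vec n r" using im r by blast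
    text \<open>The last unknown \<open>c n\<close> homogenizes the system \<open>S w \<in> F\<^sup>K\<close>, \<open>w = v\<close> outside \<open>I0\<close>.\<close>
    define f where "f j u = (if u = j then 1 else if u = n then - v $ j else 0)" for j u
    define g where "g j u = (if u < n then S $$ (j, u) else 0)" for j u
    let ?E = "f ` ({..<n} - I0) \<union> g ` ({..<n} - K)"
    have "card ?E \<le> card (f ` ({..<n} - I0)) + card (g ` ({..<n} - K))" by (rule card_Un_le)
    also have "\<dots> \<le> card ({..<n} - I0) + card ({..<n} - K)" by (intro add_mono card_image_le) auto
    also have "\<dots> = n" using fin0 I0(2) card_compl card_lt by (simp add: card_Diff_subset)
    finally have "card ?E < card {..n}" by simp
    then obtain c where c: "\<exists>u\<in>{..n}. c u \<noteq> 0" and c0: "\<And>\<phi>. \<phi> \<in> ?E \<Longrightarrow> (\<Sum>u\<in>{..n}. \<phi> u * c u) = 0"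
      using homogeneous_system_nontrivial[of ?E "{..n}"] by blast
    have split: "(\<Sum>u\<in>{..n}. h u) = (\<Sum>u<n. h u) + h n" for h :: "nat \<Rightarrow> 'a"
      by (simp add: lessThan_Suc_atMost[symmetric])
    define w where "w = vec n c"
    have w: "w \<in> carrier_vec n" by (simp add: w_def)
    have wv: "w $ j = c n * v $ j" if "j < n" "j \<notin> I0" for j
    proof -
      have "0 = (\<Sum>u<n. f j u * c u) + f j n * c n" using c0[of "f j"] split that by auto
      also have "(\<Sum>u<n. f j u * c u) = (\<Sum>u<n. if u = j then c u else 0)"
        by (intro sum.cong) (auto simp: f_def)
      also have "\<dots> = c j" using that by simp
      finally show ?thesis using that by (simp add: f_def w_def)
    qed
    have "(S *\<^sub>v w) $ j = 0" if "j \<in> {..<n} - K" for j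
    proof -
      have "0 = (\<Sum>u<n. g j u * c u) + g j n * c n" using c0[of "g j"] split that by auto
      also have "\<dots> = (\<Sum>u<n. S $$ (j, u) * w $ u)" by (simp add: g_def w_def)
      also have "\<dots> = (S *\<^sub>v w) $ j" using S_sum w that by auto
      finally show ?thesis by simp
    qed
    then have wW: "w \<in> W" using w by (simp add: W_def)
    \<comment> \<open>If \<open>c n\<close> were zero, \<open>w\<close> would be a vector of
      \<open>W\<close> supported on \<open>I0\<close>, hence zero, and the solution \<open>c\<close>
      would be trivial.\<close>
    have t: "c n \<noteq> 0"
    proof
      assume "c n = 0"
      then have "w = 0\<^sub>v n" using generic[OF wW fin0(2)] I0(2) wv by simp
      then have "c u = 0" if "u < n" for u using that by (metis w_def index_vec index_zero_vec(1))
      with c \<open>c n = 0\<close> show False by (metis atMost_iff le_neq_implies_less)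
    qed
    have "X *\<^sub>v w = X *\<^sub>v (c n \<cdot>\<^sub>v v)"
      using wv I0(1) v(1) by (intro mult_mat_vec_cong_off_zero_cols[OF X w _ I_col]) auto
    also have "\<dots> = c n \<cdot>\<^sub>v unit_vec n r" using X v by (simp add: mult_mat_vec)
    finally have Xw: "X *\<^sub>v w = c n \<cdot>\<^sub>v unit_vec n r" .
    have "X *\<^sub>v w = 0\<^sub>v n"
    proof (rule generic[OF inv[OF wW], of "{r}"])
      show "card {r} \<le> n - card K" using card_lt by simp
    qed (use rn Xw in \<open>auto simp: unit_vec_def\<close>)
    then have "(c n \<cdot>\<^sub>v unit_vec n r) $ r = 0\<^sub>v n $ r" using Xw by simp
    then show False using t rn by simp
  next
    case False
    \<comment> \<open>Prescribing zeros of \<open>X *\<^sub>v w\<close> on \<open>Q\<close> still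
      leaves a nonzero \<open>w\<close> in \<open>W\<close>, while \<open>R - Q\<close> is small
      enough to force \<open>X *\<^sub>v w\<close> to vanish. Then \<open>w\<close> lies in the
      kernel, whose dimension is below \<open>n - card K\<close>, so it is zero. Truncated
      subtraction makes \<open>Q\<close> empty if \<open>card K \<le> card I\<close>.\<close>
    obtain Q where Q: "Q \<subseteq> R" "card Q = min (card R) (card K - card I)"
      using obtain_subset_with_card_n[of "min (card R) (card K - card I)" R] by auto
    have finQ: "finite Q" using Q(1) fin(2) finite_subset by blast
    define f where "f j u = X $$ (j, u)" for j u
    define g where "g j u = S $$ (j, u)" for j u
    let ?E = "f ` Q \<union> g ` ({..<n} - K)"
    have "card ?E \<le> card (f ` Q) + card (g ` ({..<n} - K))" by (rule card_Un_le)
    also have "\<dots> \<le> card Q + card ({..<n} - K)" using finQ by (intro add_mono card_image_le) auto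
    also have "\<dots> < n" using Q(2) card_compl card_pos card_lt by linarith
    finally have "card ?E < card {..<n}" by simp
    then obtain c where c: "\<exists>u\<in>{..<n}. c u \<noteq> 0" and c0: "\<And>\<phi>. \<phi> \<in> ?E \<Longrightarrow> (\<Sum>u<n. \<phi> u * c u) = 0"
      using homogeneous_system_nontrivial[of ?E "{..<n}"] finQ by blast
    define w where "w = vec n c"
    have w: "w \<in> carrier_vec n" by (simp add: w_def)
    have "(S *\<^sub>v w) $ j = 0" if "j \<in> {..<n} - K" for j
      using S_sum[OF w, of j] c0[of "g j"] that by (simp add: g_def w_def)
    then have wW: "w \<in> W" using w by (simp add: W_def)
    have Xw_Q: "(X *\<^sub>v w) $ j = 0" if "j \<in> Q" for j
    proof -
      have j: "j < n" using that Q(1) sub(2) by auto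
      then show ?thesis
        using mult_mat_vec_index[OF X w j] c0[of "f j"] that by (simp add: f_def w_def)
    qed
    have Xw: "X *\<^sub>v w = 0\<^sub>v n"
    proof (rule generic[OF inv[OF wW], of "R - Q"])
      show "card (R - Q) \<le> n - card K"
        using Q finQ rank card_lt by (simp add: card_Diff_subset)
      show "(X *\<^sub>v w) $ j = 0" if "j < n" "j \<notin> R - Q" for j
        using that Xw_Q im'[OF w] by blast
    qed (use sub(2) in auto)
    have "w = 0\<^sub>v n"
      using generic[OF wW sub(1)] False ker[OF w Xw] by simp
    then have "c u = 0" if "u < n" for u using that by (metis w_def index_vec index_zero_vec(1))
    with c show False by auto
  qed
qed

section \<open>Scalar shifts and conjugation by an invertible matrix\<close>

lemma mult_add_scalar_commute:
  fixes A :: "'a :: comm_ring_1 mat"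
  assumes A: "A \<in> carrier_mat n n" and X: "X \<in> carrier_mat n n" and comm: "A * X = X * A"
  shows "A * (X + c \<cdot>\<^sub>m 1\<^sub>m n) = (X + c \<cdot>\<^sub>m 1\<^sub>m n) * A"
proof -
  have "A * (X + c \<cdot>\<^sub>m 1\<^sub>m n) = A * X + c \<cdot>\<^sub>m A"
    using mult_add_distrib_mat[OF A X, of "c \<cdot>\<^sub>m 1\<^sub>m n"] mult_smult_distrib[OF A, of "1\<^sub>m n" n c] A
    by simp
  also have "\<dots> = (X + c \<cdot>\<^sub>m 1\<^sub>m n) * A"
    using add_mult_distrib_mat[OF X, of "c \<cdot>\<^sub>m 1\<^sub>m n" A n]
      mult_smult_assoc_mat[of "1\<^sub>m n" n n A n c] A comm by simp
  finally show ?thesis .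
qed

text \<open>With the inverse as a parameter the situation is symmetric, so \<open>swap\<close>
  transfers every fact to conjugation in the other direction.\<close>

locale mat_conj =
  fixes n :: nat and S S' :: "'a :: field mat"
  assumes S [simp]: "S \<in> carrier_mat n n" and S' [simp]: "S' \<in> carrier_mat n n"
    and inv: "S * S' = 1\<^sub>m n" "S' * S = 1\<^sub>m n"
begin

lemma swap: "mat_conj n S' S"
  using S S' inv by unfold_locales

lemma cancel: "M \<in> carrier_mat n n \<Longrightarrow> S' * (S * M) = M"
  using assoc_mult_mat[OF S' S, of M n] inv by simp

lemma conj_mult:
  assumes P: "P \<in> carrier_mat n n" and Q: "Q \<in> carrier_mat n n"
  shows "(S * P * S') * (S * Q * S') = S * (P * Q) * S'"
proof -
  note assoc = assoc_mult_mat[of _ n n _ n _ n]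
  note car = mult_carrier_mat[of _ n n _ n] P Q
  have "(S * P * S') * (S * Q * S') = S * (P * (S' * (S * (Q * S'))))"
    by (simp add: assoc car del: assoc_mult_mat)
  also have "\<dots> = S * (P * (Q * S'))" using cancel[of "Q * S'"] car by simp
  also have "\<dots> = S * (P * Q) * S'" by (simp add: assoc car del: assoc_mult_mat)
  finally show ?thesis .
qed

lemma conj_conj:
  assumes P: "P \<in> carrier_mat n n"
  shows "S' * (S * P * S') * S = P"
proof -
  note assoc = assoc_mult_mat[of _ n n _ n _ n]
  note car = mult_carrier_mat[of _ n n _ n] P
  have "S' * (S * P * S') * S = S' * (S * (P * (S' * S)))"
    by (simp add: assoc car del: assoc_mult_mat)
  also have "\<dots> = P" using inv P cancel[OF P] by simp
  finally show ?thesis .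
qed

lemma conj_scalar: "S * (c \<cdot>\<^sub>m 1\<^sub>m n) * S' = c \<cdot>\<^sub>m 1\<^sub>m n"
proof -
  have "S * (c \<cdot>\<^sub>m 1\<^sub>m n) = c \<cdot>\<^sub>m S" using mult_smult_distrib[OF S, of "1\<^sub>m n" n c] right_mult_one_mat[OF S] by simp
  then show ?thesis using mult_smult_assoc_mat[OF S S', of c] inv by simp
qed

lemma conj_add_scalar:
  assumes P: "P \<in> carrier_mat n n"
  shows "S * (P + c \<cdot>\<^sub>m 1\<^sub>m n) * S' = S * P * S' + c \<cdot>\<^sub>m 1\<^sub>m n"
proof -
  have "S * (P + c \<cdot>\<^sub>m 1\<^sub>m n) = S * P + S * (c \<cdot>\<^sub>m 1\<^sub>m n)"
    by (rule mult_add_distrib_mat[OF S P]) simp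
  also have "\<dots> * S' = S * P * S' + S * (c \<cdot>\<^sub>m 1\<^sub>m n) * S'"
    by (rule add_mult_distrib_mat[OF _ _ S']) (use P in \<open>auto intro: mult_carrier_mat[OF S]\<close>)
  finally show ?thesis by (simp add: conj_scalar)
qed

lemma conj_commute:
  assumes "P \<in> carrier_mat n n" "Q \<in> carrier_mat n n" "P * Q = Q * P"
  shows "(S * P * S') * (S * Q * S') = (S * Q * S') * (S * P * S')"
  using assms by (simp add: conj_mult del: assoc_mult_mat)

lemma conj_nonscalar:
  assumes P: "P \<in> carrier_mat n n" "P \<notin> scalar_mats n"
  shows "S * P * S' \<notin> scalar_mats n"
proof
  assume "S * P * S' \<in> scalar_mats n"
  then obtain c where "S * P * S' = c \<cdot>\<^sub>m 1\<^sub>m n" by (auto simp: scalar_mats_def)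
  then have "P = S' * (c \<cdot>\<^sub>m 1\<^sub>m n) * S" using conj_conj[OF P(1)] by simp
  then have "P = c \<cdot>\<^sub>m 1\<^sub>m n" using mat_conj.conj_scalar[OF swap] by simp
  then show False using P(2) by (auto simp: scalar_mats_def)
qed

end

text \<open>The first unit vector is an eigenvector of \<open>X\<close> with eigenvalue
  \<open>X $$ (0, 0)\<close>. Subtracting this scalar keeps commutation and makes the matrix
  singular; it stays nonzero because \<open>X\<close> is not scalar.\<close>

lemma nonderogatory_shift_col0:
  fixes X :: "'a :: field mat"
  assumes X: "X \<in> carrier_mat n n" "X \<notin> scalar_mats n"
    and comm: "bidiag_mat n d l * X = X * bidiag_mat n d l" and nd: "nonderogatory n d l" and "0 < n"
  defines "X1 \<equiv> X + (- X $$ (0, 0)) \<cdot>\<^sub>m 1\<^sub>m n"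
  shows "X1 \<in> carrier_mat n n" "bidiag_mat n d l * X1 = X1 * bidiag_mat n d l"
    and "X1 \<noteq> 0\<^sub>m n n" and "i < n \<Longrightarrow> X1 $$ (i, 0) = 0"
proof -
  show X1: "X1 \<in> carrier_mat n n" using X by (simp add: X1_def)
  show comm1: "bidiag_mat n d l * X1 = X1 * bidiag_mat n d l"
    unfolding X1_def using X(1) comm by (intro mult_add_scalar_commute) auto
  show "X1 \<noteq> 0\<^sub>m n n"
  proof
    assume eq: "X1 = 0\<^sub>m n n"
    have "X = X $$ (0, 0) \<cdot>\<^sub>m 1\<^sub>m n"
    proof (rule eq_matI)
      fix i j assume "i < dim_row (X $$ (0, 0) \<cdot>\<^sub>m 1\<^sub>m n)" "j < dim_col (X $$ (0, 0) \<cdot>\<^sub>m 1\<^sub>m n)"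
      then have ij: "i < n" "j < n" by auto
      then have "X1 $$ (i, j) = 0" by (simp add: eq)
      then show "X $$ (i, j) = (X $$ (0, 0) \<cdot>\<^sub>m 1\<^sub>m n) $$ (i, j)"
        using ij X(1) by (auto simp: X1_def)
    qed (use X(1) in auto)
    then show False using X(2) by (auto simp: scalar_mats_def)
  qed
  show "X1 $$ (i, 0) = 0" if "i < n"
  proof (cases "i = 0")
    case True
    then show ?thesis using X(1) \<open>0 < n\<close> by (simp add: X1_def)
  next
    case False
    then show ?thesis using nonderogatory_commute_col0[OF X1 comm1 nd _ that] by simp
  qed
qed

section \<open>Kernels and images of commuting matrices are coordinate subspaces\<close>

lemma mult_mat_zero_vec:
  fixes A :: "'a :: semiring_0 mat"
  assumes "A \<in> carrier_mat m n"
  shows "A *\<^sub>v 0\<^sub>v n = 0\<^sub>v m"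
  using assms by (intro eq_vecI) auto

lemma mult_unit_vec_index:
  fixes X :: "'a :: semiring_1 mat"
  assumes X: "X \<in> carrier_mat n n" and "i < n" "j < n"
  shows "(X *\<^sub>v unit_vec n i) $ j = X $$ (j, i)"
proof -
  have "(\<Sum>k<n. X $$ (j, k) * unit_vec n i $ k) = (\<Sum>k<n. if k = i then X $$ (j, k) else 0)"
    using assms(2) by (intro sum.cong) (auto simp: unit_vec_def)
  then show ?thesis using assms by (simp add: mult_mat_vec_index del: index_mult_mat_vec)
qed

text \<open>The kernel of \<open>X\<close> is invariant under the Jordan matrix, so it contains the
  unit vector at every position where one of its vectors is nonzero.\<close>

lemma nonderogatory_commute_kernel:
  fixes X :: "'a :: field mat"
  assumes X: "X \<in> carrier_mat n n" and comm: "bidiag_mat n d l * X = X * bidiag_mat n d l"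
    and nd: "nonderogatory n d l"
    and w: "w \<in> carrier_vec n" "X *\<^sub>v w = 0\<^sub>v n" and i: "i < n" "w $ i \<noteq> 0" and j: "j < n"
  shows "X $$ (j, i) = 0"
proof -
  let ?A = "bidiag_mat n d l" and ?W = "{w \<in> carrier_vec n. X *\<^sub>v w = 0\<^sub>v n}"
  have A0: "?A *\<^sub>v 0\<^sub>v n = 0\<^sub>v n" by (intro eq_vecI) auto
  have "unit_vec n i \<in> ?W"
  proof (rule nonderogatory_invariant_subspace[OF nd])
    show "u + v \<in> ?W" if "u \<in> ?W" "v \<in> ?W" for u v
      using that X by (auto simp: mult_add_distrib_mat_vec)
    show "c \<cdot>\<^sub>v u \<in> ?W" if "u \<in> ?W" for c u
      using that X by (auto simp: mult_mat_vec)
    show "?A *\<^sub>v u \<in> ?W" if "u \<in> ?W" for u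
    proof -
      have u: "u \<in> carrier_vec n" "X *\<^sub>v u = 0\<^sub>v n" using that by auto
      have "X *\<^sub>v (?A *\<^sub>v u) = ?A *\<^sub>v (X *\<^sub>v u)"
        using comm assoc_mult_mat_vec[OF X bidiag_mat_carrier u(1), of d l]
          assoc_mult_mat_vec[OF bidiag_mat_carrier X u(1), of d l] by simp
      then show ?thesis using u A0 by (simp add: mult_mat_vec_carrier[OF bidiag_mat_carrier])
    qed
  qed (use w i in auto)
  then have "(X *\<^sub>v unit_vec n i) $ j = 0" using j by simp
  then show ?thesis using mult_unit_vec_index[OF X i(1) j] by simp
qed

text \<open>As for the kernel: commutation makes the image of \<open>X\<close> an invariant
  subspace.\<close>

lemma nonderogatory_commute_image:
  fixes X :: "'a :: field mat"
  assumes X: "X \<in> carrier_mat n n" and comm: "bidiag_mat n d l * X = X * bidiag_mat n d l"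
    and nd: "nonderogatory n d l"
    and w: "w \<in> carrier_vec n" and i: "i < n" "(X *\<^sub>v w) $ i \<noteq> 0"
  shows "\<exists>v\<in>carrier_vec n. X *\<^sub>v v = unit_vec n i"
proof -
  let ?A = "bidiag_mat n d l" and ?W = "(\<lambda>v. X *\<^sub>v v) ` carrier_vec n"
  have "unit_vec n i \<in> ?W"
  proof (rule nonderogatory_invariant_subspace[OF nd])
    show "?W \<subseteq> carrier_vec n" using mult_mat_vec_carrier[OF X] by auto
    show "u + v \<in> ?W" if uv: "u \<in> ?W" "v \<in> ?W" for u v
    proof -
      obtain a b where "a \<in> carrier_vec n" "b \<in> carrier_vec n" "u = X *\<^sub>v a" "v = X *\<^sub>v b"
        using uv by auto
      then show ?thesis using X by (intro image_eqI[of _ _ "a + b"]) (auto simp: mult_add_distrib_mat_vec)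
    qed
    show "c \<cdot>\<^sub>v u \<in> ?W" if u: "u \<in> ?W" for c u
    proof -
      obtain a where "a \<in> carrier_vec n" "u = X *\<^sub>v a" using u by auto
      then show ?thesis using X by (intro image_eqI[of _ _ "c \<cdot>\<^sub>v a"]) (auto simp: mult_mat_vec)
    qed
    show "?A *\<^sub>v u \<in> ?W" if u: "u \<in> ?W" for u
    proof -
      obtain a where a: "a \<in> carrier_vec n" "u = X *\<^sub>v a" using u by auto
      have "?A *\<^sub>v u = X *\<^sub>v (?A *\<^sub>v a)"
        using comm assoc_mult_mat_vec[OF X bidiag_mat_carrier a(1), of d l] a(2)
          assoc_mult_mat_vec[OF bidiag_mat_carrier X a(1), of d l] by simp
      then show ?thesis using a(1) by (intro image_eqI[of _ _ "?A *\<^sub>v a"]) (auto intro: mult_mat_vec_carrier[OF bidiag_mat_carrier])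
    qed
  qed (use w i in auto)
  then show ?thesis by (metis imageE)
qed

lemma nonzero_mat_entry:
  assumes X: "X \<in> carrier_mat m n" "X \<noteq> 0\<^sub>m m n"
  obtains i j where "i < m" "j < n" "X $$ (i, j) \<noteq> 0"
proof -
  have "X = 0\<^sub>m m n" if "\<And>i j. i < m \<Longrightarrow> j < n \<Longrightarrow> X $$ (i, j) = 0"
    using X(1) that by (intro eq_matI) auto
  then show ?thesis using that X(2) by blast
qed

lemma (in mat_conj) nonderogatory_no_commuting_pair:
  assumes minors: "all_minors_nonzero S" and n: "0 < n"
    and A: "nonderogatory n d l" and B: "nonderogatory n e m"
    and X: "X \<in> carrier_mat n n" "X \<notin> scalar_mats n" "bidiag_mat n d l * X = X * bidiag_mat n d l"
    and Y: "Y \<in> carrier_mat n n" "Y \<notin> scalar_mats n"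
      "(S' * bidiag_mat n e m * S) * Y = Y * (S' * bidiag_mat n e m * S)"
  shows "X * Y \<noteq> Y * X"
proof
  assume XY: "X * Y = Y * X"
  let ?B = "bidiag_mat n e m"
  define x where "x = X $$ (0, 0)"
  define X1 where "X1 = X + (- x) \<cdot>\<^sub>m 1\<^sub>m n"
  note X1 = nonderogatory_shift_col0[OF X A n, folded x_def, folded X1_def]
  define y where "y = (S * Y * S') $$ (0, 0)"
  define Y1 where "Y1 = Y + (- y) \<cdot>\<^sub>m 1\<^sub>m n"
  \<comment> \<open>Conjugating back makes the second matrix commute with the Jordan matrix
    \<open>?B\<close> itself, so that its kernel is a coordinate subspace.\<close>
  define Y2 where "Y2 = S * Y1 * S'"
  have Y1: "Y1 \<in> carrier_mat n n" using Y by (simp add: Y1_def)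
  have car: "S * Y * S' \<in> carrier_mat n n" "S' * ?B * S \<in> carrier_mat n n"
    using Y(1) by (auto intro!: mult_carrier_mat[of _ n n _ n])
  have Y2_eq: "Y2 = S * Y * S' + (- y) \<cdot>\<^sub>m 1\<^sub>m n"
    unfolding Y2_def Y1_def by (rule conj_add_scalar[OF Y(1)])
  have "?B * (S * Y * S') = S * Y * S' * ?B"
    using conj_commute[OF car(2) Y(1,3)] mat_conj.conj_conj[OF swap, of ?B] by simp
  note Y2 = nonderogatory_shift_col0[OF car(1) conj_nonscalar[OF Y(1,2)] this B n, folded y_def, folded Y2_eq]
  have X1Y1: "X1 * Y1 = Y1 * X1"
    unfolding X1_def Y1_def using X(1) Y(1) XY by (intro mult_add_scalar_commute mult_add_scalar_commute[symmetric]) auto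
  have "Y2 * S = S * Y1"
    using assoc_mult_mat[of "S * Y1" n n S' n S n] Y1 inv unfolding Y2_def
    by (simp add: mult_carrier_mat[OF S Y1] del: assoc_mult_mat)
  then have Y2S: "Y2 *\<^sub>v (S *\<^sub>v u) = S *\<^sub>v (Y1 *\<^sub>v u)" if "u \<in> carrier_vec n" for u
    using assoc_mult_mat_vec[OF Y2(1) S that] assoc_mult_mat_vec[OF S Y1 that] by simp
  define I where "I = {i. i < n \<and> (\<forall>j<n. X1 $$ (j, i) = 0)}"
  define R where "R = {r. r < n \<and> (\<exists>v\<in>carrier_vec n. X1 *\<^sub>v v = unit_vec n r)}"
  define K where "K = {k. k < n \<and> (\<forall>j<n. Y2 $$ (j, k) = 0)}"
  obtain i0 j0 where X1_ne: "i0 < n" "j0 < n" "X1 $$ (i0, j0) \<noteq> 0"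
    by (rule nonzero_mat_entry[OF X1(1,3)])
  obtain i1 j1 where Y2_ne: "i1 < n" "j1 < n" "Y2 $$ (i1, j1) \<noteq> 0"
    by (rule nonzero_mat_entry[OF Y2(1,3)])
  define W where "W = {w \<in> carrier_vec n. \<forall>j\<in>{..<n} - K. (S *\<^sub>v w) $ j = 0}"
  \<comment> \<open>The coordinate description of \<open>W\<close> amounts to \<open>W\<close> being
    the kernel of \<open>Y1\<close>, which \<open>X1\<close> preserves because the two
    commute.\<close>
  have W_iff: "w \<in> W \<longleftrightarrow> Y2 *\<^sub>v (S *\<^sub>v w) = 0\<^sub>v n" if w: "w \<in> carrier_vec n" for w
  proof
    have Sw: "S *\<^sub>v w \<in> carrier_vec n" using w mult_mat_vec_carrier[OF S] by blast
    assume "w \<in> W"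
    then have "Y2 *\<^sub>v (S *\<^sub>v w) = Y2 *\<^sub>v 0\<^sub>v n"
      by (intro mult_mat_vec_cong_off_zero_cols[OF Y2(1) Sw, where I = K])
        (auto simp: W_def K_def)
    also have "\<dots> = 0\<^sub>v n" by (rule mult_mat_zero_vec[OF Y2(1)])
    finally show "Y2 *\<^sub>v (S *\<^sub>v w) = 0\<^sub>v n" .
  next
    have Sw: "S *\<^sub>v w \<in> carrier_vec n" using w mult_mat_vec_carrier[OF S] by blast
    assume "Y2 *\<^sub>v (S *\<^sub>v w) = 0\<^sub>v n"
    then have "(S *\<^sub>v w) $ j = 0" if "j < n" "j \<notin> K" for j
      using nonderogatory_commute_kernel[OF Y2(1,2) B Sw _ that(1)] that by (auto simp: K_def)
    then show "w \<in> W" using w by (simp add: W_def)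
  qed
  show False
  proof (rule generic_no_invariant_preimage[OF S minors X1(1)])
    show "I \<subseteq> {..<n}" "R \<subseteq> {..<n}" "K \<subseteq> {..<n}" by (auto simp: I_def R_def K_def)
    show "I \<noteq> {}" using n X1(4) by (auto simp: I_def)
    show "K \<noteq> {}" using n Y2(4) by (auto simp: K_def)
    have "j1 \<notin> K" using Y2_ne by (auto simp: K_def)
    then show "K \<noteq> {..<n}" using Y2_ne(2) by blast
    have "(X1 *\<^sub>v unit_vec n j0) $ i0 \<noteq> 0" using mult_unit_vec_index[OF X1(1)] X1_ne by simp
    then have "i0 \<in> R"
      using nonderogatory_commute_image[OF X1(1,2) A unit_vec_carrier X1_ne(1)] X1_ne(1)
      by (simp add: R_def)
    then show "R \<noteq> {}" by blast
    show "X1 $$ (j, i) = 0" if "i \<in> I" "j < n" for i j using that by (simp add: I_def)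
    show "w $ j = 0" if "w \<in> carrier_vec n" "X1 *\<^sub>v w = 0\<^sub>v n" "j < n" "j \<notin> I" for w j
      using nonderogatory_commute_kernel[OF X1(1,2) A that(1-3)] that(3,4) by (auto simp: I_def)
    show "\<exists>v\<in>carrier_vec n. X1 *\<^sub>v v = unit_vec n r" if "r \<in> R" for r
      using that by (simp add: R_def)
    show "(X1 *\<^sub>v v) $ j = 0" if "v \<in> carrier_vec n" "j < n" "j \<notin> R" for v j
      using nonderogatory_commute_image[OF X1(1,2) A that(1,2)] that(2,3) by (auto simp: R_def)
    fix w assume "w \<in> {w \<in> carrier_vec n. \<forall>j\<in>{..<n} - K. (S *\<^sub>v w) $ j = 0}"
    then have "w \<in> W" and w: "w \<in> carrier_vec n" by (simp_all add: W_def)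
    have Xw: "X1 *\<^sub>v w \<in> carrier_vec n" and Yw: "Y1 *\<^sub>v w \<in> carrier_vec n"
      using w mult_mat_vec_carrier[OF X1(1)] mult_mat_vec_carrier[OF Y1] by blast+
    have "S *\<^sub>v (Y1 *\<^sub>v w) = 0\<^sub>v n" using W_iff[OF w] \<open>w \<in> W\<close> Y2S[OF w] by simp
    then have "S' *\<^sub>v (S *\<^sub>v (Y1 *\<^sub>v w)) = 0\<^sub>v n" by (simp add: mult_mat_zero_vec[OF S'])
    then have "Y1 *\<^sub>v w = 0\<^sub>v n" using assoc_mult_mat_vec[OF S' S Yw] inv Yw by simp
    then have "Y1 *\<^sub>v (X1 *\<^sub>v w) = X1 *\<^sub>v 0\<^sub>v n"
      using assoc_mult_mat_vec[OF Y1 X1(1) w] assoc_mult_mat_vec[OF X1(1) Y1 w] X1Y1 by simp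
    also have "\<dots> = 0\<^sub>v n" by (rule mult_mat_zero_vec[OF X1(1)])
    finally have "Y2 *\<^sub>v (S *\<^sub>v (X1 *\<^sub>v w)) = S *\<^sub>v 0\<^sub>v n" using Y2S[OF Xw] by simp
    also have "\<dots> = 0\<^sub>v n" by (rule mult_mat_zero_vec[OF S])
    finally show "X1 *\<^sub>v w \<in> {w \<in> carrier_vec n. \<forall>j\<in>{..<n} - K. (S *\<^sub>v w) $ j = 0}"
      using W_iff[OF Xw] by (simp add: W_def)
  qed
qed

subsection \<open>A path of length four\<close>

lemma matrix_unit_mult_zero:
  fixes M :: "'a :: semiring_1 mat"
  assumes M: "M \<in> carrier_mat n n" and "\<And>j. j < n \<Longrightarrow> M $$ (e, j) = 0"
  shows "matrix_unit n s e * M = 0\<^sub>m n n"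
proof (rule eq_matI)
  fix i j assume "i < dim_row (0\<^sub>m n n :: 'a mat)" "j < dim_col (0\<^sub>m n n :: 'a mat)"
  then have ij: "i < n" "j < n" by auto
  have "(matrix_unit n s e * M) $$ (i, j) = (\<Sum>k<n. matrix_unit n s e $$ (i, k) * M $$ (k, j))"
    by (rule mult_mat_index[OF matrix_unit_carrier M ij])
  also have "\<dots> = 0" using assms ij by (intro sum.neutral) (auto simp: matrix_unit_def)
  finally show "(matrix_unit n s e * M) $$ (i, j) = 0\<^sub>m n n $$ (i, j)" using ij by simp
qed (use M in \<open>auto simp: matrix_unit_def\<close>)

lemma mult_matrix_unit_zero:
  fixes M :: "'a :: semiring_1 mat"
  assumes M: "M \<in> carrier_mat n n" and "\<And>i. i < n \<Longrightarrow> M $$ (i, s) = 0"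
  shows "M * matrix_unit n s e = 0\<^sub>m n n"
proof (rule eq_matI)
  fix i j assume "i < dim_row (0\<^sub>m n n :: 'a mat)" "j < dim_col (0\<^sub>m n n :: 'a mat)"
  then have ij: "i < n" "j < n" by auto
  have "(M * matrix_unit n s e) $$ (i, j) = (\<Sum>k<n. M $$ (i, k) * matrix_unit n s e $$ (k, j))"
    by (rule mult_mat_index[OF M matrix_unit_carrier ij])
  also have "\<dots> = 0" using assms ij by (intro sum.neutral) (auto simp: matrix_unit_def)
  finally show "(M * matrix_unit n s e) $$ (i, j) = 0\<^sub>m n n $$ (i, j)" using ij by simp
qed (use M in \<open>auto simp: matrix_unit_def\<close>)

lemma matrix_unit_nonscalar:
  assumes "2 \<le> n" "s < n" "e < n"
  shows "matrix_unit n s e \<notin> (scalar_mats n :: 'a :: comm_ring_1 mat set)"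
proof
  assume "matrix_unit n s e \<in> (scalar_mats n :: 'a mat set)"
  then obtain c :: 'a where eq: "matrix_unit n s e = c \<cdot>\<^sub>m 1\<^sub>m n" by (auto simp: scalar_mats_def)
  have entry: "(if i = s \<and> j = e then 1 else 0) = (if i = j then c else 0)" if "i < n" "j < n" for i j
    using arg_cong[OF eq, of "\<lambda>M. M $$ (i, j)"] that by (simp add: matrix_unit_def)
  obtain t where t: "t < n" "t \<noteq> s"
    using assms(1) that[of "if s = 0 then 1 else 0"] by simp
  show False using entry[of s e] entry[of t t] t assms(2,3) by (auto split: if_splits)
qed

text \<open>Take the first cell, ending at \<open>e\<close>. Column 0 and row \<open>e\<close> of
  the Jordan matrix contain only the diagonal entry \<open>d 0\<close>, so both products are
  \<open>d 0\<close> times the matrix unit.\<close>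

lemma nonderogatory_matrix_unit_commute:
  fixes d :: "nat \<Rightarrow> 'a :: comm_ring_1"
  assumes "nonderogatory n d l" "0 < n"
  obtains s e where "s < n" "e < n"
    "bidiag_mat n d l * matrix_unit n s e = matrix_unit n s e * bidiag_mat n d l"
proof -
  define e where "e = Max {e. e < n \<and> d e = d 0}"
  have "e \<in> {e. e < n \<and> d e = d 0}" unfolding e_def using assms(2) by (intro Max_in) auto
  then have e: "e < n" "d e = d 0" by auto
  have "\<not> l e" if "Suc e < n"
  proof
    assume "l e"
    then have "d (Suc e) = d 0" using nonderogatory_link[OF assms(1) that] e by simp
    then have "Suc e \<in> {e. e < n \<and> d e = d 0}" using that by simp
    then have "Suc e \<le> e" unfolding e_def by (intro Max_ge) auto
    then show False by simp
  qed
  then have "bidiag_mat n d l * matrix_unit n 0 e = matrix_unit n 0 e * bidiag_mat n d l"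
    unfolding bidiag_commute_iff[OF matrix_unit_carrier] using e by (auto simp: matrix_unit_def)
  then show ?thesis using that[of 0 e] assms(2) e(1) by blast
qed

lemma nonderogatory_nonscalar:
  fixes d :: "nat \<Rightarrow> 'a :: comm_ring_1"
  assumes "nonderogatory n d l" "2 \<le> n"
  shows "bidiag_mat n d l \<notin> scalar_mats n"
proof
  assume "bidiag_mat n d l \<in> scalar_mats n"
  then obtain c :: 'a where eq: "bidiag_mat n d l = c \<cdot>\<^sub>m 1\<^sub>m n" by (auto simp: scalar_mats_def)
  have entry: "bidiag_mat n d l $$ (i, j) = (if i = j then c else 0)" if "i < n" "j < n" for i j
    using arg_cong[OF eq, of "\<lambda>M. M $$ (i, j)"] that by simp
  have "d 0 = c" "d 1 = c" "\<not> l 0"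
    using entry[of 0 0] entry[of 1 1] entry[of 0 1] assms(2)
    by (auto simp: bidiag_mat_def split: if_splits)
  then show False using nonderogatory_link[OF assms(1), of 0] assms(2) by simp
qed

text \<open>\<open>Z\<close> is a product of a column \<open>u\<close> and a row \<open>v\<close>.
  Annihilating \<open>E\<close> and \<open>F\<close> from one side imposes two linear conditions on
  \<open>u\<close>, from the other side two on \<open>v\<close>; with at least three unknowns both
  have nonzero solutions.\<close>

lemma (in mat_conj) common_commuting_rank_one:
  assumes n: "3 \<le> n" and s: "s < n" "e < n" "s' < n" "e' < n"
  defines "E \<equiv> matrix_unit n s e" and "F \<equiv> S' * matrix_unit n s' e' * S"
  obtains Z where "Z \<in> carrier_mat n n" "Z \<notin> scalar_mats n" "E * Z = Z * E" "F * Z = Z * F"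
proof -
  have two: "\<exists>u. (\<exists>k\<in>{..<n}. u k \<noteq> 0) \<and> u i = 0 \<and> (\<Sum>k<n. f k * u k) = 0" if i: "i < n"
    for i and f :: "nat \<Rightarrow> 'a"
  proof -
    let ?g = "\<lambda>k. if k = i then 1 else 0 :: 'a"
    have "card {?g, f} \<le> 2" by (simp add: card_insert_if)
    then have "card {?g, f} < card {..<n}" using n by simp
    then obtain u where u: "\<exists>k\<in>{..<n}. u k \<noteq> 0"
      and u0: "\<And>\<phi>. \<phi> \<in> {?g, f} \<Longrightarrow> (\<Sum>k<n. \<phi> k * u k) = 0"
      using homogeneous_system_nontrivial[of "{?g, f}" "{..<n}"] by blast
    have "(\<Sum>k<n. ?g k * u k) = (\<Sum>k<n. if k = i then u k else 0)" by (intro sum.cong) auto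
    then have "u i = 0" using u0[of ?g] i by simp
    then show ?thesis using u u0[of f] by blast
  qed
  obtain u where u: "\<exists>k\<in>{..<n}. u k \<noteq> 0" "u e = 0" "(\<Sum>k<n. S $$ (e', k) * u k) = 0"
    using two[OF s(2), of "\<lambda>k. S $$ (e', k)"] by blast
  obtain v where v: "\<exists>k\<in>{..<n}. v k \<noteq> 0" "v s = 0" "(\<Sum>k<n. S' $$ (k, s') * v k) = 0"
    using two[OF s(1), of "\<lambda>k. S' $$ (k, s')"] by blast
  define Z where "Z = mat n n (\<lambda>(i, j). u i * v j)"
  have Z: "Z \<in> carrier_mat n n" by (simp add: Z_def)
  note car = mult_carrier_mat[of _ n n _ n]
  note assoc = assoc_mult_mat[of _ n n _ n _ n]
  have EZ: "E * Z = 0\<^sub>m n n"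
    unfolding E_def using u(2) s by (intro matrix_unit_mult_zero[OF Z]) (simp add: Z_def)
  have ZE: "Z * E = 0\<^sub>m n n"
    unfolding E_def using v(2) s by (intro mult_matrix_unit_zero[OF Z]) (simp add: Z_def)
  have "matrix_unit n s' e' * (S * Z) = 0\<^sub>m n n"
  proof (rule matrix_unit_mult_zero)
    fix j assume j: "j < n"
    have "(S * Z) $$ (e', j) = (\<Sum>k<n. S $$ (e', k) * u k) * v j"
      unfolding mult_mat_index[OF S Z s(4) j] sum_distrib_right
      using j by (intro sum.cong) (auto simp: Z_def mult.assoc)
    then show "(S * Z) $$ (e', j) = 0" using u(3) by simp
  qed (rule car[OF S Z])
  moreover have "F * Z = S' * (matrix_unit n s' e' * (S * Z))"
    unfolding F_def by (simp add: assoc car Z del: assoc_mult_mat)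
  ultimately have FZ: "F * Z = 0\<^sub>m n n" using S' by simp
  have "(Z * S') * matrix_unit n s' e' = 0\<^sub>m n n"
  proof (rule mult_matrix_unit_zero)
    fix i assume i: "i < n"
    have "(Z * S') $$ (i, s') = u i * (\<Sum>k<n. S' $$ (k, s') * v k)"
      unfolding mult_mat_index[OF Z S' i s(3)] sum_distrib_left
      using i by (intro sum.cong) (auto simp: Z_def mult_ac)
    then show "(Z * S') $$ (i, s') = 0" using v(3) by simp
  qed (rule car[OF Z S'])
  moreover have "Z * F = (Z * S') * matrix_unit n s' e' * S"
    unfolding F_def by (simp add: assoc car Z del: assoc_mult_mat)
  ultimately have ZF: "Z * F = 0\<^sub>m n n" using S by simp
  have "Z \<notin> scalar_mats n"
  proof
    assume "Z \<in> scalar_mats n"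
    then obtain c where c: "Z = c \<cdot>\<^sub>m 1\<^sub>m n" by (auto simp: scalar_mats_def)
    have Z_entry: "u i * v j = (if i = j then c else 0)" if "i < n" "j < n" for i j
      using arg_cong[OF c, of "\<lambda>M. M $$ (i, j)"] that by (simp add: Z_def)
    \<comment> \<open>Since \<open>u e = 0\<close>, a diagonal entry of \<open>Z\<close> vanishes; a
      scalar \<open>Z\<close> would thus be zero, although \<open>u\<close> and \<open>v\<close> are
      not.\<close>
    have "c = 0" using Z_entry[of e e] u(2) s(2) by simp
    then have "u i * v j = 0" if "i < n" "j < n" for i j using Z_entry that by simp
    then show False using u(1) v(1) by (metis lessThan_iff mult_eq_0_iff)
  qed
  then show ?thesis using that Z EZ ZE FZ ZF by simp
qed

subsection \<open>Walks in the commuting graph\<close>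

lemma verts_commuting_graph: "verts (commuting_graph n) = carrier_mat n n - scalar_mats n"
  by (simp add: commuting_graph_def Let_def)

lemma arcs_commuting_graph:
  "e \<in> arcs (commuting_graph n) \<longleftrightarrow> fst e \<in> verts (commuting_graph n) \<and>
     snd e \<in> verts (commuting_graph n) \<and> fst e \<noteq> snd e \<and> fst e * snd e = snd e * fst e"
  by (auto simp: commuting_graph_def Let_def)

lemma tail_head_commuting_graph:
  "tail (commuting_graph n) = fst" "head (commuting_graph n) = snd"
  by (simp_all add: commuting_graph_def Let_def)

interpretation commuting_graph: wf_digraph "commuting_graph n" for n
  by (rule wf_digraph_commuting_graph)

text \<open>The empty walk covers the case of equal vertices, so a chain of commuting matrices
  yields a walk without any check of distinctness.\<close>

lemma commuting_graph_awalk_le_1: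
  assumes "X \<in> verts (commuting_graph n)" "Y \<in> verts (commuting_graph n)" "X * Y = Y * X"
  obtains p where "commuting_graph.awalk n X p Y" "length p \<le> 1"
proof (cases "X = Y")
  case True
  then show ?thesis using that[of "[]"] assms by (simp add: commuting_graph.awalk_Nil_iff)
next
  case False
  then show ?thesis using that[of "[(X, Y)]"] assms
    by (simp add: commuting_graph.awalk_simps arcs_commuting_graph tail_head_commuting_graph)
qed

text \<open>An empty walk is padded by the trivial step from \<open>X\<close> to itself, so that
  short walks need no separate treatment.\<close>

lemma commuting_graph_awalk_first_step:
  assumes "commuting_graph.awalk n X p Y" "length p \<le> Suc k"
  obtains Z q where "Z \<in> verts (commuting_graph n)" "X * Z = Z * X"
    "commuting_graph.awalk n Z q Y" "length q \<le> k"
proof (cases p)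
  case Nil
  then show ?thesis using that[of X "[]"] assms by (auto simp: commuting_graph.awalk_Nil_iff)
next
  case (Cons e q)
  then show ?thesis using that[of "snd e" q] assms
    by (auto simp: commuting_graph.awalk_Cons_iff arcs_commuting_graph tail_head_commuting_graph)
qed

lemma commuting_graph_dist_le_4:
  assumes V: "X0 \<in> verts (commuting_graph n)" "X1 \<in> verts (commuting_graph n)"
      "X2 \<in> verts (commuting_graph n)" "X3 \<in> verts (commuting_graph n)"
      "X4 \<in> verts (commuting_graph n)"
    and comm: "X0 * X1 = X1 * X0" "X1 * X2 = X2 * X1" "X2 * X3 = X3 * X2" "X3 * X4 = X4 * X3"
  shows "graph_dist (commuting_graph n) X0 X4 \<le> 4"
proof -
  obtain p where p: "commuting_graph.awalk n X0 p X1" "length p \<le> 1"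
    using commuting_graph_awalk_le_1[OF V(1,2) comm(1)] .
  obtain q where q: "commuting_graph.awalk n X1 q X2" "length q \<le> 1"
    using commuting_graph_awalk_le_1[OF V(2,3) comm(2)] .
  obtain r where r: "commuting_graph.awalk n X2 r X3" "length r \<le> 1"
    using commuting_graph_awalk_le_1[OF V(3,4) comm(3)] .
  obtain s where s: "commuting_graph.awalk n X3 s X4" "length s \<le> 1"
    using commuting_graph_awalk_le_1[OF V(4,5) comm(4)] .
  let ?p = "p @ q @ r @ s"
  have "commuting_graph.awalk n X0 ?p X4"
    using p q r s by (intro commuting_graph.awalk_appendI)
  then have "graph_dist (commuting_graph n) X0 X4 \<le> ereal (wf_digraph.awalk_cost (\<lambda>_. 1) ?p)"
    unfolding graph_dist_def by (rule commuting_graph.min_cost_le_walk_cost)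
  also have "wf_digraph.awalk_cost (\<lambda>_. 1) ?p = real (length ?p)"
    by (simp add: commuting_graph.awalk_cost_def sum_list_triv)
  also have "ereal (real (length ?p)) \<le> 4" using p q r s by simp
  finally show ?thesis .
qed

text \<open>Padding turns any walk of length at most three into exactly three commuting steps, whose
  middle one is excluded by assumption.\<close>

lemma commuting_graph_dist_ge_4:
  assumes "\<And>Y Z. Y \<in> verts (commuting_graph n) \<Longrightarrow> Z \<in> verts (commuting_graph n) \<Longrightarrow>
    X * Y = Y * X \<Longrightarrow> Z * X' = X' * Z \<Longrightarrow> Y * Z \<noteq> Z * Y"
  shows "4 \<le> graph_dist (commuting_graph n) X X'"
  unfolding graph_dist_def commuting_graph.\<mu>_def
proof (rule INF_greatest)
  fix p assume "p \<in> {p. commuting_graph.awalk n X p X'}"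
  then have p: "commuting_graph.awalk n X p X'" by simp
  have "\<not> length p \<le> 3"
  proof
    assume "length p \<le> 3"
    then have "length p \<le> Suc 2" by simp
    then obtain Y q where Y: "Y \<in> verts (commuting_graph n)" "X * Y = Y * X"
      "commuting_graph.awalk n Y q X'" "length q \<le> 2"
      using commuting_graph_awalk_first_step[OF p] by blast
    then have "length q \<le> Suc 1" by simp
    then obtain Z r where Z: "Z \<in> verts (commuting_graph n)" "Y * Z = Z * Y"
      "commuting_graph.awalk n Z r X'" "length r \<le> 1"
      using commuting_graph_awalk_first_step[OF Y(3)] by blast
    then have "length r \<le> Suc 0" by simp
    then obtain U t where U: "Z * U = U * Z" "commuting_graph.awalk n U t X'" "length t \<le> 0"
      using commuting_graph_awalk_first_step[OF Z(3)] by blast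
    then have "U = X'" by (simp add: commuting_graph.awalk_Nil_iff)
    with U(1) assms[OF Y(1) Z(1) Y(2)] Z(2) show False by simp
  qed
  then have "4 \<le> real (length p)" by simp
  also have "\<dots> = wf_digraph.awalk_cost (\<lambda>_. 1) p" by (simp add: commuting_graph.awalk_cost_def sum_list_triv)
  finally show "4 \<le> ereal (wf_digraph.awalk_cost (\<lambda>_. 1) p)" by simp
qed

section \<open>Application to the given matrices and the exact distance\<close>

lemma minimal_jordan_matrix:
  fixes n_as :: "(nat \<times> 'a :: alg_closed_field) list"
  assumes "jordan_matrix n_as \<in> carrier_mat n n" "minimal_mat n (jordan_matrix n_as)"
  obtains d l where "jordan_matrix n_as = bidiag_mat n d l" "nonderogatory n d l"
proof -
  have "n = sum_list (map fst n_as)" using assms(1) by (metis carrier_matD(1) jordan_matrix_dim(1))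
  then show ?thesis
    using jordan_matrix_eq_bidiag_mat[of n_as] assms(2) that
      minimal_bidiag_nonderogatory[OF infinite_UNIV_alg_closed_field] by metis
qed

text \<open>Taking all rows and columns in the vanishing lemma shows that \<open>S\<close> has
  trivial kernel, so its determinant is nonzero and the inverse exists.\<close>

lemma all_minors_nonzero_mat_inverse:
  fixes S :: "'a :: field mat"
  assumes S: "S \<in> carrier_mat n n" "all_minors_nonzero S"
  shows "mat_conj n S (the (mat_inverse S))"
proof -
  have "det S \<noteq> 0"
  proof
    assume "det S = 0"
    then obtain w where w: "w \<in> carrier_vec n" "w \<noteq> 0\<^sub>v n" "S *\<^sub>v w = 0\<^sub>v n"
      using det_0_iff_vec_prod_zero_field[OF S(1)] by blast
    have "w = 0\<^sub>v n"
      by (rule all_minors_nonzero_imp_zero[OF S w(1), of "{..<n}" "{..<n}"]) (auto simp: w(3))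
    with w(2) show False by simp
  qed
  then have "S \<in> Units (ring_mat TYPE('a) n ())" by (rule det_non_zero_imp_unit[OF S(1)])
  then obtain T where T: "mat_inverse S = Some T"
    using mat_inverse(1)[OF S(1), where b = "()"] by (cases "mat_inverse S") auto
  from mat_inverse(2)[OF S(1) T] S(1) T show ?thesis by unfold_locales auto
qed

theorem theorem2p5:
  fixes n :: nat and S A B :: "'a :: alg_closed_field mat"
    and n_as m_bs :: "(nat \<times> 'a) list"
  assumes "n \<ge> 3"
    and "S \<in> carrier_mat n n" and "all_minors_nonzero S"
    and "A \<in> carrier_mat n n" and "0 \<notin> fst ` set n_as" and "A = jordan_matrix n_as"
    and "minimal_mat n A"
    and "B \<in> carrier_mat n n" and "0 \<notin> fst ` set m_bs" and "B = jordan_matrix m_bs"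
    and "minimal_mat n B"
  shows "graph_dist (commuting_graph n) A (the (mat_inverse S) * B * S) = 4"
proof -
  define S' where "S' = the (mat_inverse S)"
  interpret mat_conj n S S'
    unfolding S'_def using assms(2,3) by (rule all_minors_nonzero_mat_inverse)
  interpret swap: mat_conj n S' S by (rule swap)
  obtain d l where A: "A = bidiag_mat n d l" "nonderogatory n d l"
    using minimal_jordan_matrix[of n_as n] assms(4,6,7) by metis
  obtain e m where B: "B = bidiag_mat n e m" "nonderogatory n e m"
    using minimal_jordan_matrix[of m_bs n] assms(8,10,11) by metis
  have n: "0 < n" "2 \<le> n" using assms(1) by auto
  obtain s t where st: "s < n" "t < n" "A * matrix_unit n s t = matrix_unit n s t * A"
    using nonderogatory_matrix_unit_commute[OF A(2) n(1)] A(1) by metis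
  obtain s' t' where st': "s' < n" "t' < n" "B * matrix_unit n s' t' = matrix_unit n s' t' * B"
    using nonderogatory_matrix_unit_commute[OF B(2) n(1)] B(1) by metis
  let ?E = "matrix_unit n s t :: 'a mat" and ?F = "S' * matrix_unit n s' t' * S" and ?B = "S' * B * S"
  obtain Z where Z: "Z \<in> carrier_mat n n" "Z \<notin> scalar_mats n" "?E * Z = Z * ?E" "?F * Z = Z * ?F"
    using common_commuting_rank_one[OF assms(1) st(1,2) st'(1,2)] .
  note car = mult_carrier_mat[of _ n n _ n]
  \<comment> \<open>The walk runs through \<open>A\<close>, \<open>?E\<close>, \<open>Z\<close>,
    \<open>?F\<close> and \<open>?B\<close>.\<close>
  have "graph_dist (commuting_graph n) A ?B \<le> 4"
  proof (rule commuting_graph_dist_le_4)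
    show "A \<in> verts (commuting_graph n)"
      using nonderogatory_nonscalar[OF A(2) n(2)] A(1) by (simp add: verts_commuting_graph)
    show "?E \<in> verts (commuting_graph n)"
      using matrix_unit_nonscalar[OF n(2) st(1,2)] by (simp add: verts_commuting_graph)
    show "Z \<in> verts (commuting_graph n)" using Z by (simp add: verts_commuting_graph)
    show "?F \<in> verts (commuting_graph n)"
      using swap.conj_nonscalar[OF matrix_unit_carrier matrix_unit_nonscalar[OF n(2) st'(1,2)]]
      by (auto simp: verts_commuting_graph intro!: car)
    show "?B \<in> verts (commuting_graph n)"
      using swap.conj_nonscalar[OF assms(8)] nonderogatory_nonscalar[OF B(2) n(2)] B(1) assms(8)
      by (auto simp: verts_commuting_graph intro!: car)
    show "?F * ?B = ?B * ?F"
      using st'(3) by (intro swap.conj_commute assms(8) matrix_unit_carrier) simp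
  qed (use st(3) Z(3,4) in simp_all)
  moreover have "4 \<le> graph_dist (commuting_graph n) A ?B"
  proof (rule commuting_graph_dist_ge_4)
    fix X Y
    assume "X \<in> verts (commuting_graph n)" "Y \<in> verts (commuting_graph n)"
      "A * X = X * A" "Y * ?B = ?B * Y"
    then show "X * Y \<noteq> Y * X"
      using nonderogatory_no_commuting_pair[OF assms(3) n(1) A(2) B(2), of X Y]
      by (simp add: verts_commuting_graph A(1) B(1))
  qed
  ultimately show ?thesis by (simp add: S'_def)
qed

end
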